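(* Let $\mathcal{C}=C([-1,0],\mathbb{R})$ and $\mathcal{M}(\phi)=\max\{0,\max_{s\in[-1,0]}\phi(s)\}$ for $\phi\in\mathcal{C}$. Let $f:\mathbb{R}\times\mathcal{C}\to\mathbb{R}$, let $a<0$ and $b\ge 0$, and put $r(x)=\dfrac{ax}{1+bx}$. Assume: (i) $f$ is a Carathéodory function, and for every $q\in\mathbb{R}$ there exists $\vartheta(q)\ge 0$ such that, for every $\phi\in\mathcal{C}$ with $\phi(s)\ge q$ for all $s\in[-1,0]$, one has $f(t,\phi)\le\vartheta(q)$ for almost every $t\in\mathbb{R}$; (ii) for all $t\in\mathbb{R}$, $$ f(t,\phi)\ \ge\ r(\mathcal{M}(\phi))=\frac{a\mathcal{M}(\phi)}{1+b\mathcal{M}(\phi)}\quad\text{for all }\phi\in\mathcal{C},$$ $$ f(t,\phi)\ \le\ r(-\mathcal{M}(-\phi))=\frac{-a\mathcal{M}(-\phi)}{1-b\mathcal{M}(-\phi)}\quad\text{for all }\phi\in\mathcal{C}\text{ with }\min_{s\in[-1,0]}\phi(s)>-b^{-1},$$ where $-b^{-1}=-\infty$ if $b=0$; (iii) the integral $\int_0^{+\infty}f(s,p_s)\,ds$ diverges for every continuous function $p$ having a nonzero limit at $+\infty$, where $p_s(\theta)=p(s+\theta)$, $\theta\in[-1,0]$. Assume moreover that either $b>0$ and $|a|\le 3/2$, or $b=0$ and $|a|<3/2$. Then all solutions of $$x'(t)=f(t,x_t),\qquad x_t(s)=x(t+s),\ s\in[-1,0],$$ converge to zero as $t\to+\i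nfty$.
   Context: A function $f:\mathbb{R}\times\mathcal{C}\to\mathbb{R}$ is a Carathéodory function if $f(t,\phi)$ is measurable in $t$ for each fixed $\phi$, continuous in $\phi$ for each fixed $t$, and for any $(t,\phi)\in\mathbb{R}\times\mathcal{C}$ there are a neighbourhood $V(t,\phi)$ and a Lebesgue integrable function $m$ such that $|f(s,\psi)|\le m(s)$ for all $(s,\psi)\in V(t,\phi)$. The space $\mathcal{C}$ carries the supremum norm. A solution is a continuous function $x:[\alpha-1,\omega)\to\mathbb{R}$, for some initial time $\alpha\in\mathbb{R}$, that is locally absolutely continuous on $[\alpha,\omega)$, satisfies the equation for almost every $t\in[\alpha,\omega)$, and is defined on its maximal interval of existence. *)

theory Defs
  imports "HOL-Analysis.Analysis"
begin

text \<open>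
  The space of continuous functions from \<open>[-1,0]\<close> to the reals with the supremum metric.
  Its points are the continuous functions on \<open>[-1,0]\<close> extended by \<^const>\<open>undefined\<close> outside
  (see \<open>mspace_histories\<close> below), so that they are determined by their values on \<open>[-1,0]\<close>.
\<close>

definition histories :: "(real \<Rightarrow> real) metric" where
  "histories = cfunspace (top_of_set {-1..0}) euclidean_metric"

definition seg :: "(real \<Rightarrow> real) \<Rightarrow> real \<Rightarrow> real \<Rightarrow> real" where
  "seg x t = (\<lambda>s\<in>{-1..0}. x (t + s))"

definition yorke_max :: "(real \<Rightarrow> real) \<Rightarrow> real" where
  "yorke_max \<phi> = max 0 (SUP s\<in>{-1..0}. \<phi> s)"

definition caratheodory :: "(real \<Rightarrow> (real \<Rightarrow> real) \<Rightarrow> real) \<Rightarrow> bool" where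
  "caratheodory f \<longleftrightarrow>
     (\<forall>\<phi>\<in>mspace histories. (\<lambda>t. f t \<phi>) \<in> borel_measurable lebesgue) \<and>
     (\<forall>t. continuous_map (mtopology_of histories) euclideanreal (f t)) \<and>
     (\<forall>t. \<forall>\<phi>\<in>mspace histories. \<exists>V m.
        openin (prod_topology euclideanreal (mtopology_of histories)) V \<and> (t, \<phi>) \<in> V \<and>
        integrable lebesgue m \<and> (\<forall>(s, \<psi>)\<in>V. \<bar>f s \<psi>\<bar> \<le> m s))"

definition abs_continuous_on :: "real set \<Rightarrow> (real \<Rightarrow> real) \<Rightarrow> bool" where
  "abs_continuous_on S x \<longleftrightarrow>
     (\<forall>\<epsilon>>0. \<exists>\<delta>>0. \<forall>D.
        finite D \<and> (\<forall>(u, v)\<in>D. u \<le> v \<and> {u..v} \<subseteq> S) \<and>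
        disjoint_family_on (\<lambda>(u, v). {u<..<v}) D \<and> (\<Sum>(u, v)\<in>D. v - u) < \<delta>
        \<longrightarrow> (\<Sum>(u, v)\<in>D. \<bar>x v - x u\<bar>) < \<epsilon>)"

text \<open>The interval \<open>[c,\<omega>)\<close> with \<open>\<omega>\<close> possibly infinite.\<close>

definition right_open :: "real \<Rightarrow> ereal \<Rightarrow> real set" where
  "right_open c \<omega> = {t. c \<le> t \<and> ereal t < \<omega>}"

definition locally_abs_continuous_on :: "real set \<Rightarrow> (real \<Rightarrow> real) \<Rightarrow> bool" where
  "locally_abs_continuous_on S x \<longleftrightarrow> (\<forall>c d. {c..d} \<subseteq> S \<longrightarrow> abs_continuous_on {c..d} x)"

text \<open>
  Functions on \<open>[\<alpha>-1,\<omega>)\<close> solving the equation, first without and then with maximality of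
  the interval of existence.  Values outside \<open>[\<alpha>-1,\<omega>)\<close> are irrelevant.
\<close>

definition solves_on ::
  "(real \<Rightarrow> (real \<Rightarrow> real) \<Rightarrow> real) \<Rightarrow> real \<Rightarrow> ereal \<Rightarrow> (real \<Rightarrow> real) \<Rightarrow> bool" where
  "solves_on f \<alpha> \<omega> x \<longleftrightarrow>
     ereal \<alpha> < \<omega> \<and>
     continuous_on (right_open (\<alpha> - 1) \<omega>) x \<and>
     locally_abs_continuous_on (right_open \<alpha> \<omega>) x \<and>
     (AE t in lebesgue. t \<in> right_open \<alpha> \<omega> \<longrightarrow>
        (x has_real_derivative f t (seg x t)) (at t))"

definition is_solution ::
  "(real \<Rightarrow> (real \<Rightarrow> real) \<Rightarrow> real) \<Rightarrow> real \<Rightarrow> ereal \<Rightarrow> (real \<Rightarrow> real) \<Rightarrow> bool" where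
  "is_solution f \<alpha> \<omega> x \<longleftrightarrow>
     solves_on f \<alpha> \<omega> x \<and>
     \<not> (\<exists>\<omega>' y. \<omega> < \<omega>' \<and> solves_on f \<alpha> \<omega>' y \<and> (\<forall>t\<in>right_open (\<alpha> - 1) \<omega>. y t = x t))"

text \<open>Divergence means that the partial integrals have no finite limit.\<close>

definition integral_diverges :: "(real \<Rightarrow> real) \<Rightarrow> bool" where
  "integral_diverges g \<longleftrightarrow> \<not> (\<exists>L. ((\<lambda>T. LINT s:{0..T}|lebesgue. g s) \<longlongrightarrow> L) at_top)"

lemma mspace_histories:
  "mspace histories = {\<phi> \<in> extensional {-1..0}. continuous_on {-1..0} \<phi>}"
proof -
  have "bounded (\<phi> ` {-1..0})"
    if "continuous_on {-1..0} \<phi>" for \<phi> :: "real \<Rightarrow> real"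
    using compact_imp_bounded[OF compact_continuous_image[OF that compact_Icc]] .
  then show ?thesis
    by (auto simp: histories_def mtopology_of_def)
qed

lemma seg_in_histories:
  assumes "continuous_on {t - 1..t} x"
  shows "seg x t \<in> mspace histories"
proof -
  have "continuous_on {-1..0} (\<lambda>s. x (t + s))"
    by (rule continuous_on_compose2[OF assms]) (auto intro!: continuous_intros)
  then have "continuous_on {-1..0} (seg x t)"
    by (rule continuous_on_eq) (simp add: seg_def)
  then show ?thesis
    by (simp add: mspace_histories seg_def)
qed

end

theory Submission
  imports Defs "HOL-Complex_Analysis.Great_Picard"
begin

text \<open>
  One may take \<open>|a| = 3/2\<close> when \<open>b > 0\<close>. A solution of constant sign is eventually monotone, and a
  nonzero limit would make the integral in (iii) converge. An oscillating solution with limit superior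
  \<open>S\<close> and limit inferior \<open>- I\<close> is estimated on one delay interval after a zero: with
  \<open>\<rho> = \<bar>r(S)\<bar>\<close> one gets \<open>I \<le> \<integral>\<^sub>0\<^sup>1 \<bar>r(min(S, \<rho> v))\<bar> dv\<close>, and symmetrically for \<open>S\<close>. Rational
  bounds for the logarithms that occur give \<open>I \<le> 3S/(3 + 4bS)\<close> and
  \<open>S \<le> 3I/((1 - bI)(3 - bI))\<close>, where the last fraction is less than \<open>3I/(3 - 4bI)\<close> for \<open>I > 0\<close>. The
  right-hand sides \<open>3S/(3 + 4bS)\<close> and \<open>3I/(3 - 4bI)\<close> are inverse to each other, which forces
  \<open>S = I = 0\<close>. The same estimate over a finite interval bounds the solution. Global existence
  follows from a Peano theorem for the truncated right-hand side, since solutions stay bounded on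
  bounded intervals.
\<close>

section \<open>The scalar estimates\<close>

text \<open>At |a| = 3/2 there is no contraction to first order: with z = \<kappa> S, expansion of
  \<open>excursion\<close> gives S (1 - 4/3 z + 17/12 z^2 + ...). When the maps for \<kappa> = b and
  \<kappa> = -b are composed, the quadratic terms cancel as well, so the contraction is a cubic
  effect. This forces the constant 4/3 in the linear fractional bounds and calls for a logarithm
  bound exact through third order. The sides of zero are not symmetric. The upper estimate on f has
  a pole, so it can be used only once the solution stays above -1/b. The lower estimate saturates:
  downward excursions never exceed 9/(14 b), whatever S is, so an oscillating solution enters the
  admissible region by itself and is then bounded above too. For b = 0 nothing saturates, and
  boundedness needs a separate argument at the first time a level is reached. In (i) the exceptional
  null set may depend on the history, whereas a solution runs through uncountably many histories;
  continuity of f in the history and a countable set of times remove this obstacle.\<close>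

lemma ln_le_pade:
  fixes y :: real
  assumes "y > -1"
  shows "ln (1 + y) \<le> y * (6 + y) / (6 + 4 * y)"
proof -
  \<comment> \<open>The fraction is the [2/1] Pade approximant of ln(1 + z) at 0. The derivative of
    \<open>D\<close> has the sign of z, so 0 is the minimum on both sides;
    \<open>excursion_le\<close> uses both, since \<kappa> may have either sign.\<close>
  define D where "D z = z * (6 + z) / (6 + 4 * z) - ln (1 + z)" for z :: real
  have deriv: "(D has_real_derivative z^3 / ((1 + z) * (3 + 2 * z)^2)) (at z)" if "z > -1" for z
  proof -
    have nz: "6 + 4 * z \<noteq> 0" "1 + z \<noteq> 0" "3 + 2 * z \<noteq> 0" using that by auto
    have e: "((6 + 2 * z) * (6 + 4 * z) - z * (6 + z) * 4) / (6 + 4 * z)^2 - 1 / (1 + z) = z^3 / ((1 + z) * (3 + 2 * z)^2)"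
    proof -
      have "(6 + 4 * z)^2 = 4 * (3 + 2 * z)^2" by (simp add: power2_eq_square algebra_simps)
      then show ?thesis using nz by (simp add: divide_simps) (simp add: power2_eq_square power3_eq_cube algebra_simps)
    qed
    show ?thesis unfolding D_def e[symmetric]
      by (rule derivative_eq_intros refl | use that nz in \<open>simp add: power2_eq_square\<close>)+
  qed
  have "D 0 \<le> D y"
  proof (cases "y \<ge> 0")
    case True
    show ?thesis
    proof (rule DERIV_nonneg_imp_nondecreasing[where f = D, OF True])
      fix x :: real assume "0 \<le> x" "x \<le> y"
      then show "\<exists>d. (D has_real_derivative d) (at x) \<and> 0 \<le> d"
        using deriv[of x] by (intro exI[of _ "x^3 / ((1 + x) * (3 + 2 * x)^2)"]) auto
    qed
  next
    case False
    show ?thesis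
    proof (rule DERIV_nonpos_imp_nonincreasing[where f = D])
      show "y \<le> 0" using False by simp
    next
      fix x :: real assume "y \<le> x" "x \<le> 0"
      moreover have "x^3 \<le> 0" using \<open>x \<le> 0\<close> by (simp add: power_le_zero_eq)
      ultimately show "\<exists>d. (D has_real_derivative d) (at x) \<and> d \<le> 0"
        using deriv[of x] assms
        by (intro exI[of _ "x^3 / ((1 + x) * (3 + 2 * x)^2)"]) (auto intro!: divide_nonpos_nonneg mult_nonneg_nonneg)
    qed
  qed
  then show ?thesis by (simp add: D_def)
qed

text \<open>The [1/1] Pade approximant, exact through second order only. It serves
  \<open>excursion_le_far\<close>, whose purpose is the range of large \<kappa> S.\<close>

lemma ln_ge_pade:
  fixes y :: real
  assumes "y \<ge> 0"
  shows "2 * y / (2 + y) \<le> ln (1 + y)"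
proof -
  define D where "D z = ln (1 + z) - 2 * z / (2 + z)" for z :: real
  have deriv: "(D has_real_derivative z^2 / ((1 + z) * (2 + z)^2)) (at z)" if "z \<ge> 0" for z
  proof -
    have nz: "2 + z \<noteq> 0" "1 + z \<noteq> 0" using that by auto
    have e: "1 / (1 + z) - (2 * (2 + z) - 2 * z) / (2 + z)^2 = z^2 / ((1 + z) * (2 + z)^2)"
      using nz by (simp add: divide_simps) (simp add: power2_eq_square algebra_simps)
    show ?thesis unfolding D_def e[symmetric]
      by (rule derivative_eq_intros refl | use that nz in \<open>simp add: power2_eq_square\<close>)+
  qed
  have "D 0 \<le> D y"
  proof (rule DERIV_nonneg_imp_nondecreasing[where f = D, OF assms])
    fix x :: real assume "0 \<le> x" "x \<le> y"
    then show "\<exists>d. (D has_real_derivative d) (at x) \<and> 0 \<le> d"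
      using deriv[of x] by (intro exI[of _ "x^2 / ((1 + x) * (2 + x)^2)"]) auto
  qed
  then show ?thesis by (simp add: D_def)
qed

text \<open>This is |r| at the extreme value |a| = 3/2. A negative \<kappa> puts a pole at y =
  -1/\<kappa>, whence the recurring side condition \<open>1 + \<kappa> * y > 0\<close>.\<close>

definition feedback :: "real \<Rightarrow> real \<Rightarrow> real" where
  "feedback \<kappa> y = (3 / 2) * y / (1 + \<kappa> * y)"

text \<open>A solution that is at most \<open>S\<close> and vanishes at \<open>t0\<close> stays above \<open>- excursion \<kappa> S\<close> until its next
  zero: its slope before \<open>t0\<close> is at least \<open>- feedback \<kappa> S\<close>, which bounds the delayed values that drive
  it on \<open>[t0, t0 + 1]\<close>. Solutions use \<open>\<kappa> = b\<close> below zero and, after reflection, \<open>\<kappa> = - b\<close> above.\<close>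

definition excursion :: "real \<Rightarrow> real \<Rightarrow> real" where
  "excursion \<kappa> S = integral {0..1} (\<lambda>v. feedback \<kappa> (min S (feedback \<kappa> S * v)))"

lemma feedback_denom_pos:
  fixes \<kappa> S y :: real
  assumes "1 + \<kappa> * S > 0" "0 \<le> y" "y \<le> S"
  shows "1 + \<kappa> * y > 0"
proof (cases "\<kappa> \<ge> 0")
  case True
  then show ?thesis using assms by (simp add: add_pos_nonneg)
next
  case False
  then have "\<kappa> * S \<le> \<kappa> * y" using assms by (simp add: mult_left_mono_neg)
  then show ?thesis using assms by linarith
qed

lemma feedback_nonneg: "0 \<le> y \<Longrightarrow> 1 + \<kappa> * y > 0 \<Longrightarrow> 0 \<le> feedback \<kappa> y"
  by (simp add: feedback_def)

lemma feedback_0 [simp]: "feedback \<kappa> 0 = 0"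
  by (simp add: feedback_def)

lemma feedback_mono:
  assumes "0 \<le> y" "y \<le> z" "1 + \<kappa> * z > 0"
  shows "feedback \<kappa> y \<le> feedback \<kappa> z"
proof -
  have "1 + \<kappa> * y > 0" using feedback_denom_pos assms by blast
  then show ?thesis using assms
    by (simp add: feedback_def divide_simps) (simp add: algebra_simps)
qed

lemma continuous_on_feedback_min:
  assumes "0 \<le> S" "1 + \<kappa> * S > 0" "0 \<le> \<rho>"
  shows "continuous_on {0..} (\<lambda>v. feedback \<kappa> (min S (\<rho> * v)))"
  unfolding feedback_def
proof (intro continuous_intros ballI)
  fix v :: real assume "v \<in> {0..}"
  then have "0 \<le> min S (\<rho> * v)" using assms by auto
  then have "1 + \<kappa> * min S (\<rho> * v) > 0" using feedback_denom_pos[OF assms(2), of "min S (\<rho> * v)"] by auto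
  then show "1 + \<kappa> * min S (\<rho> * v) \<noteq> 0" by linarith
qed

lemma has_integral_feedback:
  assumes "\<kappa> \<noteq> 0" "\<rho> > 0" "u \<ge> 0" "1 + \<kappa> * (\<rho> * u) > 0"
  shows "((\<lambda>v. feedback \<kappa> (\<rho> * v)) has_integral
           (3 / 2) / \<kappa> * (u - ln (1 + \<kappa> * (\<rho> * u)) / (\<kappa> * \<rho>))) {0..u}"
proof -
  let ?W = "\<lambda>v. (3 / 2) / \<kappa> * (v - ln (1 + \<kappa> * (\<rho> * v)) / (\<kappa> * \<rho>))"
  have "((\<lambda>v. feedback \<kappa> (\<rho> * v)) has_integral ?W u - ?W 0) {0..u}"
  proof (rule fundamental_theorem_of_calculus[OF assms(3)])
    fix v assume v: "v \<in> {0..u}"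
    have "\<rho> * v \<le> \<rho> * u" "0 \<le> \<rho> * v" using v assms by auto
    then have pos: "1 + \<kappa> * (\<rho> * v) > 0"
      using feedback_denom_pos[OF assms(4)] by blast
    have "feedback \<kappa> (\<rho> * v) = (3 / 2) / \<kappa> * (1 - (\<kappa> * \<rho>) / (1 + \<kappa> * (\<rho> * v)) / (\<kappa> * \<rho>))"
      using pos assms unfolding feedback_def by (simp add: divide_simps)
    moreover have "(?W has_real_derivative (3 / 2) / \<kappa> * (1 - (\<kappa> * \<rho>) / (1 + \<kappa> * (\<rho> * v)) / (\<kappa> * \<rho>))) (at v within {0..u})"
      using pos assms by (auto intro!: derivative_eq_intros simp: divide_simps) (simp add: algebra_simps)
    ultimately show "(?W has_vector_derivative feedback \<kappa> (\<rho> * v)) (at v within {0..u})"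
      by (simp add: has_real_derivative_iff_has_vector_derivative)
  qed
  then show ?thesis by simp
qed

lemma excursion_0 [simp]: "excursion \<kappa> 0 = 0"
proof -
  have "excursion \<kappa> 0 = integral {0..1} (\<lambda>v::real. 0)"
    unfolding excursion_def by (rule integral_cong) simp
  then show ?thesis by simp
qed

lemma excursion_le:
  assumes "\<kappa> \<noteq> 0" "S \<ge> 0" "1 + \<kappa> * S > 0" "\<kappa> * S \<le> 1 / 2"
  shows "excursion \<kappa> S \<le> 3 * S / ((1 + \<kappa> * S) * (3 + \<kappa> * S))"
proof (cases "S = 0")
  case False
  define \<rho> where "\<rho> = feedback \<kappa> S"
  \<comment> \<open>The point where \<open>\<rho> * v\<close> reaches \<open>S\<close> and the
    minimum in \<open>excursion\<close> switches. The hypothesis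
    \<open>\<kappa> * S \<le> 1 / 2\<close> says exactly that it lies in the range of
    integration.\<close>
  define v0 where "v0 = (1 + \<kappa> * S) / (3 / 2)"
  define z where "z = \<kappa> * S"
  have S: "S > 0" using False assms by simp
  have \<rho>: "\<rho> > 0" using S assms by (simp add: \<rho>_def feedback_def)
  have v0: "0 \<le> v0" "v0 \<le> 1" and \<rho>v0: "\<rho> * v0 = S"
    using assms by (auto simp: v0_def \<rho>_def feedback_def field_simps)
  have z: "z > -1" "z \<noteq> 0" "z \<le> 1 / 2" using assms S by (auto simp: z_def)
  have 1: "((\<lambda>v. feedback \<kappa> (min S (\<rho> * v))) has_integral
            (3 / 2) / \<kappa> * (v0 - ln (1 + \<kappa> * S) / (\<kappa> * \<rho>))) {0..v0}"
  proof (rule has_integral_eq)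
    show "((\<lambda>v. feedback \<kappa> (\<rho> * v)) has_integral (3 / 2) / \<kappa> * (v0 - ln (1 + \<kappa> * S) / (\<kappa> * \<rho>))) {0..v0}"
      using has_integral_feedback[of \<kappa> \<rho> v0] assms \<rho> v0 \<rho>v0 by simp
    fix v assume "v \<in> {0..v0}"
    then have "\<rho> * v \<le> S" using \<rho>v0 \<rho> by (metis atLeastAtMost_iff mult_le_cancel_left_pos)
    then show "feedback \<kappa> (\<rho> * v) = feedback \<kappa> (min S (\<rho> * v))" by simp
  qed
  have 2: "((\<lambda>v. feedback \<kappa> (min S (\<rho> * v))) has_integral \<rho> * (1 - v0)) {v0..1}"
  proof (rule has_integral_eq)
    show "((\<lambda>v. \<rho>) has_integral \<rho> * (1 - v0)) {v0..1}"
      using has_integral_const_real[of \<rho> v0 1] v0 by (simp add: mult.commute)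
    fix v assume "v \<in> {v0..1}"
    then have "S \<le> \<rho> * v" using \<rho>v0 \<rho> by (metis atLeastAtMost_iff mult_le_cancel_left_pos)
    then show "\<rho> = feedback \<kappa> (min S (\<rho> * v))" by (simp add: \<rho>_def)
  qed
  have "excursion \<kappa> S = (3 / 2) / \<kappa> * (v0 - ln (1 + \<kappa> * S) / (\<kappa> * \<rho>)) + \<rho> * (1 - v0)"
    using has_integral_combine[OF v0 1 2] unfolding excursion_def \<rho>_def by blast
  also have "\<dots> = (S / z) * ((1 + z) - (1 + z) / z * ln (1 + z) + (3 / 2) * z / (1 + z) - z)"
  proof -
    define L where "L = ln (1 + z)"
    have e: "\<kappa> = z / S" "\<rho> = (3 / 2) * S / (1 + z)" "v0 = (1 + z) / (3 / 2)"
      using S by (auto simp: z_def v0_def \<rho>_def feedback_def)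
    have "1 + \<kappa> * S = 1 + z" "\<kappa> * \<rho> = (3 / 2) * z / (1 + z)" "(3 / 2) / \<kappa> = (3 / 2) * S / z"
      using S by (auto simp: e)
    then have "(3 / 2) / \<kappa> * (v0 - ln (1 + \<kappa> * S) / (\<kappa> * \<rho>)) + \<rho> * (1 - v0)
        = (3 / 2) * S / z * ((1 + z) / (3 / 2) - L / ((3 / 2) * z / (1 + z))) + (\<rho> - \<rho> * v0)"
      by (simp add: L_def e(3) right_diff_distrib)
    also have "\<dots> = (3 / 2) * S / z * ((1 + z) / (3 / 2) - L / ((3 / 2) * z / (1 + z))) + ((3 / 2) * S / (1 + z) - S)"
      by (simp add: \<rho>v0) (simp add: e(2))
    also have "\<dots> = (S / z) * ((1 + z) - (1 + z) / z * L + (3 / 2) * z / (1 + z) - z)"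
    proof -
      have nz: "1 + z \<noteq> 0" using z by simp
      have "(3 / 2) * S / z * ((1 + z) / (3 / 2) - L / ((3 / 2) * z / (1 + z))) = S / z * (1 + z) - S / z * ((1 + z) / z * L)"
      proof -
        have "L / ((3 / 2) * z / (1 + z)) = ((1 + z) / z * L) / (3 / 2)"
          by (simp add: algebra_simps)
        then have "(3 / 2) * S / z * ((1 + z) / (3 / 2) - L / ((3 / 2) * z / (1 + z)))
            = (3 / 2) * (S / z) * ((1 + z) / (3 / 2) - ((1 + z) / z * L) / (3 / 2))" by simp
        also have "\<dots> = S / z * (1 + z) - S / z * ((1 + z) / z * L)"
        proof -
          have "(3 / 2) * c * (A / (3 / 2) - B / (3 / 2)) = c * A - c * B" for c A B :: real
            by (simp add: right_diff_distrib)
          then show ?thesis .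
        qed
        finally show ?thesis .
      qed
      moreover have "(3 / 2) * S / (1 + z) - S = S / z * ((3 / 2) * z / (1 + z)) - S / z * z"
        using z nz by simp
      ultimately show ?thesis by (simp only: right_diff_distrib distrib_left)
    qed
    finally show ?thesis by (simp add: L_def)
  qed
  also have "\<dots> \<le> (S / z) * (3 * z / ((1 + z) * (3 + z)))"
  proof -
    \<comment> \<open>A lower bound for ln(1 + z) is wanted, but the accurate bound is an upper one.
      It is applied at the point where 1 + y = 1/(1 + z), which flips the sign of the logarithm and
      works for either sign of z.\<close>
    have "ln (1 + (- z / (1 + z))) \<le> (- z / (1 + z)) * (6 + (- z / (1 + z))) / (6 + 4 * (- z / (1 + z)))"
      using z by (intro ln_le_pade) (simp add: divide_simps)
    moreover have "1 + (- z / (1 + z)) = inverse (1 + z)" using z by (simp add: divide_simps)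
    moreover have "(- z / (1 + z)) * (6 + (- z / (1 + z))) / (6 + 4 * (- z / (1 + z))) = - (z * (6 + 5 * z) / ((1 + z) * (6 + 2 * z)))"
    proof -
      have e1: "6 + (- z / (1 + z)) = (6 + 5 * z) / (1 + z)" "6 + 4 * (- z / (1 + z)) = (6 + 2 * z) / (1 + z)"
        using z by (simp_all add: field_simps)
      have nz: "1 + z \<noteq> 0" "6 + 2 * z \<noteq> 0" using z by auto
      show ?thesis unfolding e1 using nz by (simp add: divide_simps)
    qed
    ultimately have ln: "z * (6 + 5 * z) / ((1 + z) * (6 + 2 * z)) \<le> ln (1 + z)"
      using z by (simp add: ln_inverse)
    have "S / z * ((1 + z) / z) = S * (1 + z) / z^2" by (simp add: power2_eq_square)
    also have "\<dots> \<ge> 0" using S z by simp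
    finally have pos: "S / z * ((1 + z) / z) \<ge> 0" .
    have "S / z * ((1 + z) - (1 + z) / z * ln (1 + z) + (3 / 2) * z / (1 + z) - z)
        = S / z * ((1 + z) + (3 / 2) * z / (1 + z) - z) - S / z * ((1 + z) / z) * ln (1 + z)"
      
    proof -
      have "c * (A - B * l + D - z) = c * (A + D - z) - c * B * l" for c A B D l :: real
        by (simp add: algebra_simps)
      then show ?thesis .
    qed
    also have "\<dots> \<le> S / z * ((1 + z) + (3 / 2) * z / (1 + z) - z) - S / z * ((1 + z) / z) * (z * (6 + 5 * z) / ((1 + z) * (6 + 2 * z)))"
      using mult_left_mono[OF ln pos] by linarith
    also have "\<dots> = S / z * (3 * z / ((1 + z) * (3 + z)))"
    proof -
      have nz: "1 + z \<noteq> 0" "6 + 2 * z = 2 * (3 + z)" "3 + z \<noteq> 0" using z by auto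
      show ?thesis unfolding nz(2) using nz z by (simp add: divide_simps) (simp add: algebra_simps)
    qed
    finally show ?thesis .
  qed
  also have "\<dots> = 3 * S / ((1 + \<kappa> * S) * (3 + \<kappa> * S))"
    using z by (simp add: z_def)
  finally show ?thesis .
qed simp

text \<open>Dropping the minimum with \<open>S\<close> only enlarges the integrand, because
  \<open>feedback\<close> is monotone. The resulting bound stays below 9/(14 \<kappa>) for every S,
  which later gives an a priori bound for oscillating solutions.\<close>

lemma excursion_le_far:
  assumes "\<kappa> > 0" "S \<ge> 0"
  shows "excursion \<kappa> S \<le> (9 / 2) * S / (4 + 7 * (\<kappa> * S))"
proof (cases "S = 0")
  case False
  define \<rho> where "\<rho> = feedback \<kappa> S"
  have S: "S > 0" using False assms by simp
  have dpos: "1 + \<kappa> * S > 0" using assms by (simp add: add_pos_nonneg)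
  have \<rho>: "\<rho> > 0" using S assms dpos by (simp add: \<rho>_def feedback_def)
  have pos: "1 + \<kappa> * (\<rho> * 1) > 0" using assms \<rho> by (simp add: add_pos_pos)
  note h = has_integral_feedback[OF _ \<rho> _ pos, simplified]
  have "excursion \<kappa> S \<le> (3 / 2) / \<kappa> * (1 - ln (1 + \<kappa> * \<rho>) / (\<kappa> * \<rho>))"
    unfolding excursion_def
  proof (rule has_integral_le)
    have "continuous_on {0..1} (\<lambda>v. feedback \<kappa> (min S (\<rho> * v)))"
      by (rule continuous_on_subset[OF continuous_on_feedback_min]) (use assms dpos \<rho> in auto)
    then show "((\<lambda>v. feedback \<kappa> (min S (feedback \<kappa> S * v))) has_integral integral {0..1} (\<lambda>v. feedback \<kappa> (min S (feedback \<kappa> S * v)))) {0..1}"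
      using integrable_continuous_real by (auto simp: \<rho>_def)
    show "((\<lambda>v. feedback \<kappa> (\<rho> * v)) has_integral (3 / 2) / \<kappa> * (1 - ln (1 + \<kappa> * \<rho>) / (\<kappa> * \<rho>))) {0..1}"
      using h assms by simp
    fix v :: real assume "v \<in> {0..1}"
    then show "feedback \<kappa> (min S (feedback \<kappa> S * v)) \<le> feedback \<kappa> (\<rho> * v)"
      unfolding \<rho>_def[symmetric] using \<rho> S assms
      by (intro feedback_mono) (auto intro!: add_pos_nonneg)
  qed
  also have "\<dots> \<le> (3 / 2) / \<kappa> * (1 - 2 / (2 + \<kappa> * \<rho>))"
  proof -
    have kr: "\<kappa> * \<rho> > 0" using assms \<rho> by simp
    have "2 * (\<kappa> * \<rho>) / (2 + \<kappa> * \<rho>) / (\<kappa> * \<rho>) \<le> ln (1 + \<kappa> * \<rho>) / (\<kappa> * \<rho>)"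
      using ln_ge_pade[of "\<kappa> * \<rho>"] kr by (intro divide_right_mono) auto
    moreover have "2 * (\<kappa> * \<rho>) / (2 + \<kappa> * \<rho>) / (\<kappa> * \<rho>) = 2 / (2 + \<kappa> * \<rho>)" using assms(1) \<rho> by simp
    ultimately have "2 / (2 + \<kappa> * \<rho>) \<le> ln (1 + \<kappa> * \<rho>) / (\<kappa> * \<rho>)" by linarith
    then show ?thesis using assms by (intro mult_left_mono) auto
  qed
  also have "\<dots> = (9 / 2) * S / (4 + 7 * (\<kappa> * S))"
  proof -
    have kr: "2 + \<kappa> * \<rho> > 0" using assms \<rho> by (simp add: add_pos_pos)
    have "\<rho> * (1 + \<kappa> * S) = 3 / 2 * S"
      unfolding \<rho>_def feedback_def using less_imp_neq[OF dpos] by (metis nonzero_eq_divide_eq mult.commute times_divide_eq_left)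
    then have e: "2 + \<kappa> * \<rho> = (2 + 7 / 2 * (\<kappa> * S)) / (1 + \<kappa> * S)"
    proof -
      have "(2 + \<kappa> * \<rho>) * (1 + \<kappa> * S) = 2 * (1 + \<kappa> * S) + \<kappa> * (\<rho> * (1 + \<kappa> * S))"
        by (simp add: algebra_simps)
      also have "\<dots> = 2 + 7 / 2 * (\<kappa> * S)"
        by (simp only: \<open>\<rho> * (1 + \<kappa> * S) = 3 / 2 * S\<close>) (simp add: algebra_simps)
      finally show ?thesis using dpos by (simp add: eq_divide_eq)
    qed
    have "2 + 7 / 2 * (\<kappa> * S) > 0" "4 + 7 * (\<kappa> * S) > 0" using S assms by (auto intro!: add_pos_pos)
    then show ?thesis unfolding e using dpos assms by (simp add: divide_simps)
  qed
  finally show ?thesis .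
qed simp

text \<open>For small z = \<kappa> S, (1 + z)(3 + z) = 3 + 4z + z^2 exceeds 3 + 4z. The far bound is
  below the linear fractional one exactly from z = 1/2 on, which is where the near estimate ends, so
  the two ranges just meet.\<close>

lemma excursion_le_linear_fractional:
  assumes "\<kappa> > 0" "S \<ge> 0"
  shows "excursion \<kappa> S \<le> 3 * S / (3 + 4 * (\<kappa> * S))"
proof (cases "\<kappa> * S \<le> 1 / 2")
  case True
  have nn: "\<kappa> * S \<ge> 0" using assms by simp
  have "excursion \<kappa> S \<le> 3 * S / ((1 + \<kappa> * S) * (3 + \<kappa> * S))"
    using excursion_le[of \<kappa> S] nn True assms by linarith
  also have "\<dots> \<le> 3 * S / (3 + 4 * (\<kappa> * S))"
    using nn assms by (intro divide_left_mono) (auto simp: algebra_simps intro!: mult_pos_pos add_pos_nonneg)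
  finally show ?thesis .
next
  case False
  have nn: "\<kappa> * S \<ge> 0" using assms by simp
  have "S * (1/2) \<le> S * (\<kappa> * S)" using False assms by (intro mult_left_mono) auto
  then have "(9 / 2) * S / (4 + 7 * (\<kappa> * S)) \<le> 3 * S / (3 + 4 * (\<kappa> * S))"
    using nn by (simp add: divide_simps) (simp add: algebra_simps)
  then show ?thesis using excursion_le_far[OF assms] by linarith
qed

section \<open>Excursions of a solution from a zero\<close>

text \<open>On the delay interval after \<open>t0\<close> the positive part of the history recedes:
  at time t only values at s \<ge> t - 1 count, and among those before \<open>t0\<close> the largest
  allowed by the slope bound is \<open>\<rho> * (t0 + 1 - t)\<close>. The slope bound itself looks
  one delay further back, so \<open>S\<close> must bound x from \<open>t0 - 2\<close> on.\<close>

lemma excursion_bound_from_zero: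
  fixes x g :: "real \<Rightarrow> real"
  assumes S: "S \<ge> 0" "1 + \<kappa> * S > 0"
    and int: "\<And>u v. t0 - 1 \<le> u \<Longrightarrow> u \<le> v \<Longrightarrow> v \<le> t1 \<Longrightarrow> (g has_integral (x v - x u)) {u..v}"
    and low: "\<And>t m. t \<in> {t0 - 1..t1} \<Longrightarrow> 0 \<le> m \<Longrightarrow> 1 + \<kappa> * m > 0 \<Longrightarrow>
                (\<forall>s\<in>{t - 1..t}. x s \<le> m) \<Longrightarrow> g t \<ge> - feedback \<kappa> m"
    and xS: "\<And>s. s \<in> {t0 - 2..t1} \<Longrightarrow> x s \<le> S"
    and zero: "x t0 = 0" and neg: "\<And>s. s \<in> {t0..t1} \<Longrightarrow> x s \<le> 0" and t01: "t0 \<le> t1"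
  shows "x t1 \<ge> - excursion \<kappa> S"
proof -
  define \<rho> where "\<rho> = feedback \<kappa> S"
  define t2 where "t2 = min t1 (t0 + 1)"
  have t2: "t0 \<le> t2" "t2 \<le> t1" "t2 \<le> t0 + 1" using t01 by (auto simp: t2_def)
  have \<rho>: "\<rho> \<ge> 0" using S by (simp add: \<rho>_def feedback_nonneg)
  have before: "x s \<le> \<rho> * (t0 - s)" if s: "s \<in> {t0 - 1..t0}" for s
  proof -
    have "- \<rho> * (t0 - s) \<le> x t0 - x s"
    proof (rule has_integral_le)
      show "((\<lambda>_. - \<rho>) has_integral - \<rho> * (t0 - s)) {s..t0}"
        using has_integral_const_real[of "- \<rho>" s t0] s by (simp add: mult.commute)
      show "(g has_integral x t0 - x s) {s..t0}" using int[of s t0] s t01 by auto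
      fix t assume "t \<in> {s..t0}"
      then show "- \<rho> \<le> g t"
        unfolding \<rho>_def using low[of t S] S s xS t01 by auto
    qed
    then show ?thesis using zero by simp
  qed
  let ?G = "\<lambda>v. feedback \<kappa> (min S (\<rho> * v))"
  have contG: "continuous_on {0..1} ?G"
    by (rule continuous_on_subset[OF continuous_on_feedback_min[OF S \<rho>]]) simp
  have Gnn: "?G v \<ge> 0" if "v \<ge> 0" for v
    using that S \<rho> by (intro feedback_nonneg feedback_denom_pos[OF S(2)]) auto
  have reflect: "(?G has_integral I) {t0 + 1 - u..1} \<Longrightarrow> ((\<lambda>t. ?G (t0 + 1 - t)) has_integral I) {t0..u}"
    if "u \<in> {t0..t0 + 1}" for u I
  proof -
    assume I: "(?G has_integral I) {t0 + 1 - u..1}"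
    have "((\<lambda>v. ?G (- v)) has_integral I) {-1..- (t0 + 1 - u)}"
      using has_integral_reflect_real[of ?G I 1 "t0 + 1 - u"] I by blast
    from has_integral_affinity'[OF this[unfolded cbox_interval[symmetric]], of 1 "- (t0 + 1)"]
    show ?thesis by (simp add: add.commute)
  qed
  \<comment> \<open>With v = t0 + 1 - t, stopping at \<open>t2\<close> before \<open>t0 + 1\<close>
    removes an initial piece of the range of v, and the integrand is nonnegative.\<close>
  have "excursion \<kappa> S \<ge> integral {t0 + 1 - t2..1} ?G"
    unfolding excursion_def \<rho>_def[symmetric]
    by (rule integral_subset_le)
      (use t2 Gnn contG in \<open>auto intro!: integrable_continuous_real intro: continuous_on_subset\<close>)
  moreover have "- integral {t0 + 1 - t2..1} ?G \<le> x t2 - x t0"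
  proof (rule has_integral_le)
    have "(?G has_integral integral {t0 + 1 - t2..1} ?G) {t0 + 1 - t2..1}"
      by (intro integrable_integral integrable_continuous_real continuous_on_subset[OF contG]) (use t2 in auto)
    then have "((\<lambda>t. ?G (t0 + 1 - t)) has_integral integral {t0 + 1 - t2..1} ?G) {t0..t2}"
      using reflect[of t2] t2 by auto
    then show "((\<lambda>t. - ?G (t0 + 1 - t)) has_integral - integral {t0 + 1 - t2..1} ?G) {t0..t2}"
      by (rule has_integral_neg)
    show "(g has_integral x t2 - x t0) {t0..t2}" using int[of t0 t2] t2 by auto
    fix t assume t: "t \<in> {t0..t2}"
    let ?m = "min S (\<rho> * (t0 + 1 - t))"
    have m: "?m \<ge> 0" using S \<rho> t t2 by auto
    show "- ?G (t0 + 1 - t) \<le> g t"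
    proof (rule low)
      show "t \<in> {t0 - 1..t1}" "0 \<le> ?m" using t t2 m by auto
      show "1 + \<kappa> * ?m > 0" using m by (intro feedback_denom_pos[OF S(2)]) auto
      show "\<forall>s\<in>{t - 1..t}. x s \<le> ?m"
      proof
        fix s assume s: "s \<in> {t - 1..t}"
        show "x s \<le> ?m"
        proof (cases "s \<ge> t0")
          case True
          then have "x s \<le> 0" using neg[of s] s t t2 by auto
          then show ?thesis using m by linarith
        next
          case False
          then have "x s \<le> \<rho> * (t0 - s)" using before[of s] s t by auto
          also have "\<dots> \<le> \<rho> * (t0 + 1 - t)" using s \<rho> by (intro mult_left_mono) auto
          finally show ?thesis using xS[of s] s t t2 False by auto
        qed
      qed
    qed
  qed
  \<comment> \<open>After \<open>t0 + 1\<close> the whole history is nonpositive, so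
    \<open>low\<close> with m = 0 makes the slope nonnegative and x falls no further.\<close>
  moreover have "0 \<le> x t1 - x t2"
  proof (cases "t1 \<le> t0 + 1")
    case False
    show ?thesis
    proof (rule has_integral_nonneg)
      show "(g has_integral x t1 - x t2) {t2..t1}" using int[of t2 t1] t2 by auto
      fix t assume "t \<in> {t2..t1}"
      then show "0 \<le> g t" using low[of t 0] neg t2 False by (auto simp: t2_def)
    qed
  qed (simp add: t2_def)
  ultimately show ?thesis using zero by linarith
qed

lemma excursion_nonneg:
  assumes "S \<ge> 0" "1 + \<kappa> * S > 0"
  shows "excursion \<kappa> S \<ge> 0"
  unfolding excursion_def
proof (rule integral_nonneg)
  have \<rho>: "feedback \<kappa> S \<ge> 0" using assms feedback_nonneg by blast
  have "continuous_on {0..1} (\<lambda>v. feedback \<kappa> (min S (feedback \<kappa> S * v)))"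
    by (rule continuous_on_subset[OF continuous_on_feedback_min]) (use assms \<rho> in auto)
  then show "(\<lambda>v. feedback \<kappa> (min S (feedback \<kappa> S * v))) integrable_on {0..1}"
    by (rule integrable_continuous_real)
  fix v :: real assume "v \<in> {0..1}"
  then show "0 \<le> feedback \<kappa> (min S (feedback \<kappa> S * v))"
    using assms \<rho> by (intro feedback_nonneg feedback_denom_pos[OF assms(2)]) auto
qed

text \<open>The estimate is restarted from the last time in {z..t1} with x nonnegative; by the
  intermediate value theorem x vanishes there. The gap of 2 between \<open>T\<close> and
  \<open>z\<close> leaves room for the two delays that \<open>excursion_bound_from_zero\<close>
  looks back.\<close>

lemma excursion_bound_after_zero:
  fixes x g :: "real \<Rightarrow> real"
  assumes S: "S \<ge> 0" "1 + \<kappa> * S > 0"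
    and cont: "continuous_on {T..t1} x"
    and int: "\<And>u v. T + 1 \<le> u \<Longrightarrow> u \<le> v \<Longrightarrow> v \<le> t1 \<Longrightarrow> (g has_integral (x v - x u)) {u..v}"
    and low: "\<And>t m. t \<in> {T + 1..t1} \<Longrightarrow> 0 \<le> m \<Longrightarrow> 1 + \<kappa> * m > 0 \<Longrightarrow>
                (\<forall>s\<in>{t - 1..t}. x s \<le> m) \<Longrightarrow> g t \<ge> - feedback \<kappa> m"
    and xS: "\<And>s. s \<in> {T..t1} \<Longrightarrow> x s \<le> S"
    and z: "T + 2 \<le> z" "z \<le> t1" "x z = 0"
  shows "x t1 \<ge> - excursion \<kappa> S"
proof (cases "x t1 \<ge> 0")
  case True
  then show ?thesis using excursion_nonneg[OF S] by linarith
next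
  case False
  define Z where "Z = {z..t1} \<inter> x -` {0..}"
  have contz: "continuous_on {z..t1} x"
    using continuous_on_subset[OF cont] z by auto
  have "closed Z" unfolding Z_def
    by (intro continuous_closed_preimage contz) auto
  moreover have bdd: "bdd_above Z" by (auto simp: Z_def)
  moreover have "z \<in> Z" using z by (simp add: Z_def)
  ultimately have "Sup Z \<in> Z" by (intro closed_contains_Sup) auto
  define t0 where "t0 = Sup Z"
  have t0: "z \<le> t0" "t0 \<le> t1" "x t0 \<ge> 0" using \<open>Sup Z \<in> Z\<close> by (auto simp: t0_def Z_def)
  have after: "x t < 0" if "t0 < t" "t \<le> t1" for t
  proof (rule ccontr)
    assume "\<not> x t < 0"
    then have "t \<in> Z" using that t0 by (auto simp: Z_def)
    then show False using cSup_upper[OF _ bdd] that by (force simp: t0_def)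
  qed
  obtain c where c: "t0 \<le> c" "c \<le> t1" "x c = 0"
    using IVT2'[of x t1 0 t0] t0 False continuous_on_subset[OF contz, of "{t0..t1}"] by auto
  have "x t0 = 0"
    using after[of c] c by (cases "c = t0") auto
  show ?thesis
  proof (rule excursion_bound_from_zero[OF S, of t0 t1 g x])
    fix s assume "s \<in> {t0..t1}"
    then show "x s \<le> 0" using after[of s] \<open>x t0 = 0\<close> by (cases "s = t0") auto
  qed (use t0 z int low xS \<open>x t0 = 0\<close> in auto)
qed

text \<open>Eventual bounds are converted into each other: an upper bound for x yields one for -x
  through \<open>excursion b\<close>, and conversely through \<open>excursion (- b)\<close>. Passing
  to the best bounds gives two inequalities that only S = I = 0 satisfies.\<close>

lemma tendsto_0_of_oscillation:
  fixes x g :: "real \<Rightarrow> real"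
  assumes b: "b > 0"
    and cont: "continuous_on {T..} x"
    and int: "\<And>u v. T + 1 \<le> u \<Longrightarrow> u \<le> v \<Longrightarrow> (g has_integral (x v - x u)) {u..v}"
    and low: "\<And>t m. T + 1 \<le> t \<Longrightarrow> 0 \<le> m \<Longrightarrow> (\<forall>s\<in>{t - 1..t}. x s \<le> m) \<Longrightarrow> g t \<ge> - feedback b m"
    and up: "\<And>t m. T + 1 \<le> t \<Longrightarrow> 0 \<le> m \<Longrightarrow> b * m < 1 \<Longrightarrow> (\<forall>s\<in>{t - 1..t}. - x s \<le> m) \<Longrightarrow>
               g t \<le> feedback (- b) m"
    and zeros: "\<And>T'. \<exists>z\<ge>T'. x z = 0"
  shows "(x \<longlongrightarrow> 0) at_top"
proof -
  have lower: "- x t \<le> excursion b S"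
    if "T \<le> T'" "T' + 2 \<le> z" "x z = 0" "z \<le> t" "\<And>s. s \<in> {T'..t} \<Longrightarrow> x s \<le> S" "0 \<le> S" for S T' z t
  proof -
    have "x t \<ge> - excursion b S"
    proof (rule excursion_bound_after_zero[where x = x and T = T' and ?t1.0 = t and z = z and g = g])
      show "continuous_on {T'..t} x" using that by (intro continuous_on_subset[OF cont]) auto
      show "1 + b * S > 0" using b that by (simp add: add_pos_nonneg)
    qed (use that int low in auto)
    then show ?thesis by simp
  qed
  have upper: "x t \<le> excursion (- b) S"
    if "T \<le> T'" "T' + 2 \<le> z" "x z = 0" "z \<le> t" "\<And>s. s \<in> {T'..t} \<Longrightarrow> - x s \<le> S" "0 \<le> S" "b * S < 1" for S T' z t
  proof -
    have "- x t \<ge> - excursion (- b) S"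
    proof (rule excursion_bound_after_zero[where x = "\<lambda>t. - x t" and T = T' and ?t1.0 = t and z = z and g = "\<lambda>t. - g t"])
      show "continuous_on {T'..t} (\<lambda>t. - x t)" using that by (intro continuous_intros continuous_on_subset[OF cont]) auto
      show "1 + - b * S > 0" using that by simp
      fix u v assume "T' + 1 \<le> u" "u \<le> v"
      then show "((\<lambda>t. - g t) has_integral - x v - - x u) {u..v}"
        using has_integral_neg[OF int[of u v]] that by simp
    qed (use that up in auto)
    then show ?thesis by simp
  qed
  \<comment> \<open>The infima of \<open>A\<close> and \<open>B\<close> will be the positive parts
    of the limit superior of x and of -x. Working with sets of eventual bounds allows x to be
    unbounded above at this point.\<close>
  define A where "A = {s. s \<ge> 0 \<and> (\<exists>T'. \<forall>t\<ge>T'. x t \<le> s)}"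
  define B where "B = {s. s \<ge> 0 \<and> (\<exists>T'. \<forall>t\<ge>T'. - x t \<le> s)}"
  \<comment> \<open>The bound \<open>S0\<close> on {T..t} depends on t, but (9/2) S0 / (4 + 7 b S0)
    stays below its limit 9/(14 b), in which \<open>S0\<close> no longer appears.\<close>
  have i0: "(9 / 14) / b \<in> B"
  proof -
    obtain z where z: "z \<ge> T + 2" "x z = 0" using zeros by blast
    have "- x t \<le> (9 / 14) / b" if t: "t \<ge> z" for t
    proof -
      have "compact (x ` {T..t})"
        by (intro compact_continuous_image continuous_on_subset[OF cont]) auto
      then have "bounded (x ` {T..t})" by (rule compact_imp_bounded)
      then obtain S0 where "\<forall>y\<in>x ` {T..t}. norm y \<le> S0" unfolding bounded_iff by blast
      then have S0: "\<And>s. s \<in> {T..t} \<Longrightarrow> \<bar>x s\<bar> \<le> S0" by auto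
      have S0nn: "S0 \<ge> 0" using S0[of T] t z by force
      have "- x t \<le> excursion b S0"
        by (rule lower[of T z]) (use t z S0nn S0 in \<open>auto simp: abs_le_iff\<close>)
      also have "\<dots> \<le> (9 / 2) * S0 / (4 + 7 * (b * S0))" by (rule excursion_le_far[OF b S0nn])
      also have "\<dots> \<le> (9 / 14) / b"
      proof -
        have "4 + 7 * (b * S0) > 0" using b S0nn by (simp add: add_pos_nonneg)
        then show ?thesis using b by (simp add: divide_simps)
      qed
      finally show ?thesis .
    qed
    then show ?thesis using b by (auto simp: B_def)
  qed
  have AB: "3 * s / (3 + 4 * (b * s)) \<in> B" if "s \<in> A" for s
  proof -
    have s: "s \<ge> 0" and "\<exists>T'. \<forall>t\<ge>T'. x t \<le> s" using that by (auto simp: A_def)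
    then obtain T' where T': "\<And>t. t \<ge> T' \<Longrightarrow> x t \<le> s" by blast
    obtain z where z: "z \<ge> max T T' + 2" "x z = 0" using zeros by blast
    have "- x t \<le> 3 * s / (3 + 4 * (b * s))" if "t \<ge> z" for t
      using lower[of "max T T'" z t s] z that T' s excursion_le_linear_fractional[OF b s] by fastforce
    moreover have "3 * s / (3 + 4 * (b * s)) \<ge> 0" using s b by simp
    ultimately show ?thesis by (auto simp: B_def)
  qed
  have BA: "3 * s / ((1 - b * s) * (3 - b * s)) \<in> A" if "s \<in> B" "b * s < 1" for s
  proof -
    have s: "s \<ge> 0" and "\<exists>T'. \<forall>t\<ge>T'. - x t \<le> s" using that by (auto simp: B_def)
    then obtain T' where T': "\<And>t. t \<ge> T' \<Longrightarrow> - x t \<le> s" by blast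
    obtain z where z: "z \<ge> max T T' + 2" "x z = 0" using zeros by blast
    have bs: "b * s \<ge> 0" using b s by simp
    have e: "excursion (- b) s \<le> 3 * s / ((1 - b * s) * (3 - b * s))"
      using excursion_le[of "- b" s] b s bs that by simp
    have "x t \<le> 3 * s / ((1 - b * s) * (3 - b * s))" if "t \<ge> z" for t
      using upper[of "max T T'" z t s] z that T' s \<open>b * s < 1\<close> e by fastforce
    moreover have "3 * s / ((1 - b * s) * (3 - b * s)) \<ge> 0" using s that by simp
    ultimately show ?thesis by (auto simp: A_def)
  qed
  define S where "S = Inf A"
  define I where "I = Inf B"
  \<comment> \<open>Eventual boundedness above comes from the bound below: 9/14 < 1 keeps clear of
    the pole, so \<open>BA\<close> applies to the initial bound.\<close>
  have Ane: "A \<noteq> {}" using BA[OF i0] b by auto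
  have Bne: "B \<noteq> {}" using i0 by auto
  have bddA: "bdd_below A" and bddB: "bdd_below B" by (auto simp: A_def B_def)
  have S0: "S \<ge> 0" unfolding S_def using Ane by (intro cInf_greatest) (auto simp: A_def)
  have I0: "I \<ge> 0" unfolding I_def using Bne by (intro cInf_greatest) (auto simp: B_def)
  have I1: "b * I \<le> 9 / 14"
  proof -
    have "I \<le> (9 / 14) / b" unfolding I_def by (rule cInf_lower[OF i0 bddB])
    then show ?thesis using b by (simp add: divide_simps) (simp add: algebra_simps)
  qed
  have inA: "s \<in> A" if gt: "s > S" for s
  proof -
    obtain a where "a \<in> A" "a < s" using cInf_lessD[OF Ane, of s] gt unfolding S_def by blast
    then have "s \<ge> 0" and "\<exists>T'. \<forall>t\<ge>T'. x t \<le> a" by (auto simp: A_def)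
    then obtain T' where "\<forall>t\<ge>T'. x t \<le> a" by blast
    then have "\<forall>t\<ge>T'. x t \<le> s" using \<open>a < s\<close> by (meson dual_order.trans less_imp_le)
    then show ?thesis using \<open>s \<ge> 0\<close> by (auto simp: A_def)
  qed
  have inB: "s \<in> B" if gt: "s > I" for s
  proof -
    obtain a where "a \<in> B" "a < s" using cInf_lessD[OF Bne, of s] gt unfolding I_def by blast
    then have "s \<ge> 0" and "\<exists>T'. \<forall>t\<ge>T'. - x t \<le> a" by (auto simp: B_def)
    then obtain T' where "\<forall>t\<ge>T'. - x t \<le> a" by blast
    then have "\<forall>t\<ge>T'. - x t \<le> s" using \<open>a < s\<close> by (meson dual_order.trans less_imp_le)
    then show ?thesis using \<open>s \<ge> 0\<close> by (auto simp: B_def)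
  qed
  \<comment> \<open>Only bounds strictly above the infimum are known to be eventual bounds, so the
    inequality is taken to the limit from the right; likewise for \<open>le2\<close>.\<close>
  have le1: "I \<le> 3 * S / (3 + 4 * (b * S))"
  proof (rule tendsto_lowerbound)
    have "3 + 4 * (b * S) \<noteq> 0" using b S0 by (smt (verit) mult_nonneg_nonneg)
    then show "((\<lambda>s. 3 * s / (3 + 4 * (b * s))) \<longlongrightarrow> 3 * S / (3 + 4 * (b * S))) (at_right S)"
      by (intro tendsto_intros)
    show "\<forall>\<^sub>F s in at_right S. I \<le> 3 * s / (3 + 4 * (b * s))"
      unfolding eventually_at_right_field I_def
      by (intro exI[of _ "S + 1"]) (use cInf_lower[OF AB[OF inA] bddB] in auto)
  qed simp
  have le2: "S \<le> 3 * I / ((1 - b * I) * (3 - b * I))"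
  proof (rule tendsto_lowerbound)
    have "(1 - b * I) * (3 - b * I) \<noteq> 0" using I1 by simp
    then show "((\<lambda>s. 3 * s / ((1 - b * s) * (3 - b * s))) \<longlongrightarrow> 3 * I / ((1 - b * I) * (3 - b * I))) (at_right I)"
      by (intro tendsto_intros)
    have "I < 1 / b" using I1 b by (simp add: divide_simps mult.commute)
    moreover have "b * s < 1" if "s < 1 / b" for s using that b by (simp add: divide_simps mult.commute)
    ultimately show "\<forall>\<^sub>F s in at_right I. S \<le> 3 * s / ((1 - b * s) * (3 - b * s))"
      unfolding eventually_at_right_field S_def
      by (intro exI[of _ "1 / b"]) (use cInf_lower[OF BA[OF inB] bddA] in auto)
  qed simp
  have "S = 0"
  proof -
    define p q where "p = b * I" and "q = b * S"
    have pq: "0 \<le> p" "p \<le> 9 / 14" "0 \<le> q" using I1 I0 S0 b by (auto simp: p_def q_def)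
    have "p \<le> 3 * q / (3 + 4 * q)"
      using mult_left_mono[OF le1, of b] b by (simp add: p_def q_def algebra_simps)
    then have 1: "3 * p \<le> q * (3 - 4 * p)" using pq by (simp add: pos_le_divide_eq algebra_simps)
    have "q \<le> 3 * p / ((1 - p) * (3 - p))"
      using mult_left_mono[OF le2, of b] b by (simp add: p_def q_def algebra_simps)
    moreover have "(1 - p) * (3 - p) > 0" using pq by simp
    ultimately have 2: "q * ((1 - p) * (3 - p)) \<le> 3 * p" by (simp add: pos_le_divide_eq)
    \<comment> \<open>Since (1 - p)(3 - p) = (3 - 4p) + p^2, subtracting the first inequality from
      the second leaves only this cubic term: it is the whole margin at |a| = 3/2.\<close>
    have "q * p^2 \<le> 0" using 1 2 by (simp add: algebra_simps power2_eq_square)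
    then have "q = 0 \<or> p = 0" using pq by (smt (verit) mult_pos_pos zero_less_power)
    then have "q = 0" using 2 pq by auto
    then show ?thesis using b by (simp add: q_def)
  qed
  then have "I = 0" using le1 I0 by simp
  show ?thesis
  proof (rule tendstoI)
    fix e :: real assume e: "e > 0"
    then have "e / 2 \<in> A" "e / 2 \<in> B" using inA inB \<open>S = 0\<close> \<open>I = 0\<close> by auto
    then obtain T1 T2 where "\<And>t. t \<ge> T1 \<Longrightarrow> x t \<le> e / 2" "\<And>t. t \<ge> T2 \<Longrightarrow> - x t \<le> e / 2"
      unfolding A_def B_def by auto
    then show "\<forall>\<^sub>F t in at_top. dist (x t) 0 < e"
      unfolding eventually_at_top_linorder using e
      by (intro exI[of _ "max T1 T2"]) (force simp: dist_real_def abs_less_iff)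
  qed
qed

section \<open>Absolutely continuous functions\<close>

text \<open>The bridge from gauge integration to absolute continuity: the cells selected by
  \<open>q\<close> have disjoint interiors inside \<open>U\<close>, so their total length is below
  the measure of \<open>U\<close>.\<close>

lemma tagged_division_sum_small:
  assumes ac: "\<And>D. finite D \<Longrightarrow> (\<forall>(u, v)\<in>D. u \<le> v \<and> {u..v} \<subseteq> {a..b}) \<Longrightarrow>
      disjoint_family_on (\<lambda>(u, v). {u<..<v}) D \<Longrightarrow> (\<Sum>(u, v)\<in>D. v - u) < \<delta> \<Longrightarrow>
      (\<Sum>(u, v)\<in>D. \<bar>h v - h u\<bar>) < (\<epsilon> :: real)"
    and p: "p tagged_division_of {a..b::real}" and qp: "q \<subseteq> p"
    and U: "\<And>x K. (x, K) \<in> q \<Longrightarrow> K \<subseteq> U" "U \<in> lmeasurable" "measure lebesgue U < \<delta>"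
  shows "(\<Sum>(x, K)\<in>q. \<bar>h (Sup K) - h (Inf K)\<bar>) < \<epsilon>"
proof -
  \<comment> \<open>Several tagged cells may share the same one-point interval, which would spoil
    injectivity of \<open>ends\<close>. Such cells contribute 0 to the sum and are
    discarded.\<close>
  define q' where "q' = {(x, K) \<in> q. Inf K < Sup K}"
  define ends where "ends = (\<lambda>(x::real, K::real set). (Inf K, Sup K))"
  note pD = tagged_division_ofD[OF p]
  have K: "\<exists>u v. K = {u..v} \<and> u \<le> v \<and> Inf K = u \<and> Sup K = v" if "(x, K) \<in> p" for x K
  proof -
    obtain u v where "K = cbox u v" using pD(4)[OF \<open>(x, K) \<in> p\<close>] by blast
    moreover have "x \<in> K" using pD(2)[OF \<open>(x, K) \<in> p\<close>] .
    ultimately show ?thesis by auto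
  qed
  have fin: "finite q" "finite q'"
    using finite_subset[OF qp pD(1)] by (auto simp: q'_def intro: finite_subset[of _ q])
  have q'p: "q' \<subseteq> p" using qp by (auto simp: q'_def)
  have inter: "interior K = {Inf K<..<Sup K}" if xK: "(x, K) \<in> p" for x K
  proof -
    obtain u v where "K = {u..v}" "Inf K = u" "Sup K = v" using K[OF xK] by blast
    then show ?thesis by simp
  qed
  have inj: "inj_on ends q'"
  proof (rule inj_onI)
    fix c d assume c: "c \<in> q'" and d: "d \<in> q'" and e: "ends c = ends d"
    obtain x1 K1 x2 K2 where cd: "c = (x1, K1)" "d = (x2, K2)" by fastforce
    show "c = d"
    proof (rule ccontr)
      assume "c \<noteq> d"
      then have "interior K1 \<inter> interior K2 = {}" using pD(5) c d q'p cd by blast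
      moreover have "interior K1 = {Inf K1<..<Sup K1}" "interior K2 = {Inf K1<..<Sup K1}"
        using inter c d q'p cd e by (auto simp: ends_def)
      moreover have "Inf K1 < Sup K1" using c cd by (auto simp: q'_def)
      ultimately show False by auto
    qed
  qed
  have disj: "disjoint_family_on (\<lambda>(u, v). {u<..<v}) (ends ` q')"
    unfolding disjoint_family_on_def
  proof (intro ballI impI)
    fix m n assume "m \<in> ends ` q'" "n \<in> ends ` q'" "m \<noteq> n"
    then obtain x1 K1 x2 K2 where "(x1, K1) \<in> q'" "(x2, K2) \<in> q'" "m = ends (x1, K1)" "n = ends (x2, K2)"
      by auto
    then show "(case m of (u, v) \<Rightarrow> {u<..<v}) \<inter> (case n of (u, v) \<Rightarrow> {u<..<v}) = {}"
      using pD(5)[of x1 K1 x2 K2] inter[of x1 K1] inter[of x2 K2] q'p \<open>m \<noteq> n\<close>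
      by (auto simp: ends_def)
  qed
  have len: "(\<Sum>(u, v)\<in>ends ` q'. v - u) < \<delta>"
  proof -
    have "(\<Sum>(u, v)\<in>ends ` q'. v - u) = (\<Sum>i\<in>ends ` q'. measure lebesgue (case i of (u, v) \<Rightarrow> {u<..<v}))"
      by (rule sum.cong) (auto simp: ends_def q'_def)
    also have "\<dots> = measure lebesgue (\<Union>i\<in>ends ` q'. (case i of (u, v) \<Rightarrow> {u<..<v}))"
      by (rule measure_finite_Union[symmetric, OF _ _ disj]) (use fin in \<open>auto simp: ends_def q'_def\<close>)
    also have "\<dots> \<le> measure lebesgue U"
    proof (rule measure_mono_fmeasurable[OF _ _ U(2)])
      show "(\<Union>i\<in>ends ` q'. (case i of (u, v) \<Rightarrow> {u<..<v})) \<subseteq> U"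
      proof
        fix t assume "t \<in> (\<Union>i\<in>ends ` q'. (case i of (u, v) \<Rightarrow> {u<..<v}))"
        then obtain x L where xL: "(x, L) \<in> q'" "Inf L < t" "t < Sup L" by (auto simp: ends_def)
        then have "t \<in> interior L" using inter q'p by auto
        then show "t \<in> U" using U(1)[of x L] xL interior_subset by (auto simp: q'_def)
      qed
      show "(\<Union>i\<in>ends ` q'. (case i of (u, v) \<Rightarrow> {u<..<v})) \<in> sets lebesgue"
        by (rule sets.finite_UN) (use fin in auto)
    qed
    finally show ?thesis using U(3) by linarith
  qed
  have "(\<Sum>(u, v)\<in>ends ` q'. \<bar>h v - h u\<bar>) < \<epsilon>"
  proof (rule ac[OF _ _ disj len])
    show "finite (ends ` q')" using fin by simp
    show "\<forall>(u, v)\<in>ends ` q'. u \<le> v \<and> {u..v} \<subseteq> {a..b}"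
    proof -
      have "u \<le> v \<and> {u..v} \<subseteq> {a..b}" if uv: "(u, v) \<in> ends ` q'" for u v
      proof -
        obtain x L where xL: "(x, L) \<in> q'" "u = Inf L" "v = Sup L" using uv by (auto simp: ends_def)
        then have xp: "(x, L) \<in> p" using q'p by blast
        obtain u' v' where "L = {u'..v'}" "u' \<le> v'" "Inf L = u'" "Sup L = v'" using K[OF xp] by blast
        then show ?thesis using xL pD(3)[OF xp] by auto
      qed
      then show ?thesis by blast
    qed
  qed
  moreover have "(\<Sum>(u, v)\<in>ends ` q'. \<bar>h v - h u\<bar>) = (\<Sum>(x, K)\<in>q'. \<bar>h (Sup K) - h (Inf K)\<bar>)"
    by (subst sum.reindex[OF inj]) (simp add: ends_def case_prod_unfold)
  moreover have "(\<Sum>(x, K)\<in>q'. \<bar>h (Sup K) - h (Inf K)\<bar>) = (\<Sum>(x, K)\<in>q. \<bar>h (Sup K) - h (Inf K)\<bar>)"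
  proof (rule sum.mono_neutral_left[OF fin(1)])
    show "\<forall>i\<in>q - q'. (case i of (x, K) \<Rightarrow> \<bar>h (Sup K) - h (Inf K)\<bar>) = 0"
    proof clarify
      fix x L assume "(x, L) \<in> q" "(x, L) \<notin> q'"
      then have "Inf L = Sup L" using K[of x L] qp by (auto simp: q'_def)
      then show "\<bar>h (Sup L) - h (Inf L)\<bar> = 0" by simp
    qed
  qed (auto simp: q'_def)
  ultimately show ?thesis by simp
qed

text \<open>Cousin's lemma with a gauge that is an open set of small measure around the exceptional
  null set: there absolute continuity controls the increments, elsewhere differentiability does.\<close>

lemma abs_continuous_on_has_integral:
  fixes h g :: "real \<Rightarrow> real"
  assumes ab: "a \<le> b" and ac: "abs_continuous_on {a..b} h"
    and deriv: "AE t in lebesgue. t \<in> {a..b} \<longrightarrow> (h has_real_derivative g t) (at t)"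
  shows "(g has_integral (h b - h a)) {a..b}"
proof -
  obtain N where N: "\<And>t. t \<notin> N \<Longrightarrow> t \<in> {a..b} \<Longrightarrow> (h has_real_derivative g t) (at t)"
    and null: "N \<in> null_sets lebesgue"
    using AE_E3[OF deriv] by auto
  \<comment> \<open>With the value 0 on \<open>N\<close>, cells tagged in \<open>N\<close>
    contribute to the error only the increment of h, which absolute continuity makes small.\<close>
  define g' where "g' t = (if t \<in> N then 0 else g t)" for t
  have "(g' has_integral (h b - h a)) {a..b}"
    unfolding has_integral_real
  proof (intro allI impI)
    fix e :: real assume e: "e > 0"
    define e1 where "e1 = e / (2 * (b - a + 1))"
    have e1: "e1 > 0" "e1 * (b - a) < e / 2"
      using e ab by (auto simp: e1_def divide_simps)
    have "e / 2 > 0" using e by simp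
    from ac[unfolded abs_continuous_on_def, THEN spec, THEN mp, OF this]
    obtain \<delta> where \<delta>: "\<delta> > 0" and acd: "\<forall>D. finite D \<and> (\<forall>(u, v)\<in>D. u \<le> v \<and> {u..v} \<subseteq> {a..b}) \<and>
        disjoint_family_on (\<lambda>(u, v). {u<..<v}) D \<and> (\<Sum>(u, v)\<in>D. v - u) < \<delta> \<longrightarrow>
        (\<Sum>(u, v)\<in>D. \<bar>h v - h u\<bar>) < e / 2"
      by (elim exE conjE)
    obtain U where U: "open U" "N \<subseteq> U" "U - N \<in> lmeasurable" "emeasure lebesgue (U - N) < ennreal \<delta>"
      using sets_lebesgue_outer_open[of N \<delta>] null \<delta> by auto
    have Ueq: "U = (U - N) \<union> N" using U(2) by auto
    have "emeasure lebesgue U = emeasure lebesgue (U - N)"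
      using emeasure_Un_null_set[of "U - N" lebesgue N] Ueq U null by auto
    then have "emeasure lebesgue U < ennreal \<delta>" using U by simp
    moreover have "U \<in> sets lebesgue" using U by auto
    ultimately have Um: "U \<in> lmeasurable" "measure lebesgue U < \<delta>"
    proof -
      have fin: "emeasure lebesgue U < \<infinity>"
        using \<open>emeasure lebesgue U < ennreal \<delta>\<close> by (rule less_trans) simp
      then show "U \<in> lmeasurable" using \<open>U \<in> sets lebesgue\<close> by (simp add: fmeasurable_def)
      have "ennreal (measure lebesgue U) < ennreal \<delta>"
        using \<open>emeasure lebesgue U < ennreal \<delta>\<close> fin emeasure_eq_ennreal_measure[of lebesgue U] by simp
      then show "measure lebesgue U < \<delta>" using \<delta> by (simp add: ennreal_less_iff)
    qed
    have "\<exists>d>0. x \<in> {a..b} - N \<longrightarrow> (\<forall>y. \<bar>y - x\<bar> < d \<longrightarrow> \<bar>h y - h x - (y - x) * g x\<bar> \<le> e1 * \<bar>y - x\<bar>)" for x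
    proof (cases "x \<in> {a..b} - N")
      case True
      then have "(h has_derivative (\<lambda>k. g x * k)) (at x)" using N[of x] by (simp add: has_field_derivative_def)
      then obtain d where "d > 0" "\<forall>y. norm (y - x) < d \<longrightarrow> norm (h y - h x - g x * (y - x)) \<le> e1 * norm (y - x)"
        unfolding has_derivative_at_alt using e1 by blast
      then show ?thesis by (auto simp: mult.commute intro!: exI[of _ d])
    qed (auto intro: exI[of _ 1])
    then obtain d where d: "\<And>x. d x > 0"
      "\<And>x y. x \<in> {a..b} - N \<Longrightarrow> \<bar>y - x\<bar> < d x \<Longrightarrow> \<bar>h y - h x - (y - x) * g x\<bar> \<le> e1 * \<bar>y - x\<bar>"
      by metis
    define \<gamma> where "\<gamma> x = (if x \<in> N then U else ball x (d x))" for x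
    show "\<exists>\<gamma>. gauge \<gamma> \<and> (\<forall>\<D>. \<D> tagged_division_of {a..b} \<and> \<gamma> fine \<D> \<longrightarrow>
        norm ((\<Sum>(x, k)\<in>\<D>. measure lborel k *\<^sub>R g' x) - (h b - h a)) < e)"
    proof (intro exI[of _ \<gamma>] conjI allI impI)
      show "gauge \<gamma>" unfolding gauge_def \<gamma>_def using U d(1) by auto
    next
      fix p assume "p tagged_division_of {a..b} \<and> \<gamma> fine p"
      then have p: "p tagged_division_of {a..b}" and fine: "\<gamma> fine p" by auto
      note pD = tagged_division_ofD[OF p]
      define q where "q = {(x, K) \<in> p. x \<in> N}"
      have qp: "q \<subseteq> p" by (auto simp: q_def)
      have fin: "finite p" "finite q" using pD(1) finite_subset[OF qp] by auto
      have 1: "(\<Sum>(x, K)\<in>q. \<bar>h (Sup K) - h (Inf K)\<bar>) < e / 2"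
      proof (rule tagged_division_sum_small[OF _ p qp _ Um])
        fix D :: "(real \<times> real) set"
        assume "finite D" "\<forall>(u, v)\<in>D. u \<le> v \<and> {u..v} \<subseteq> {a..b}"
          "disjoint_family_on (\<lambda>(u, v). {u<..<v}) D" "(\<Sum>(u, v)\<in>D. v - u) < \<delta>"
        then show "(\<Sum>(u, v)\<in>D. \<bar>h v - h u\<bar>) < e / 2"
          using acd[THEN spec, of D] by blast
      next
        fix x K assume "(x, K) \<in> q"
        then show "K \<subseteq> U" using fineD[OF fine, of x K] by (simp add: q_def \<gamma>_def)
      qed
      have 2: "\<bar>measure lborel K * g' x - (h (Sup K) - h (Inf K))\<bar> \<le> e1 * measure lborel K" if "(x, K) \<in> p - q" for x K
      proof -
        have xN: "x \<notin> N" and xp: "(x, K) \<in> p" using that by (auto simp: q_def)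
        obtain u v where K: "K = cbox u v" using pD(4)[OF xp] by blast
        have x: "x \<in> {u..v}" "x \<in> {a..b}" using pD(2)[OF xp] pD(3)[OF xp] K by auto
        have "K \<subseteq> ball x (d x)" using fineD[OF fine xp] xN by (simp add: \<gamma>_def)
        then have uv: "\<bar>u - x\<bar> < d x" "\<bar>v - x\<bar> < d x" 
        proof -
          have "u \<in> K" "v \<in> K" using K x(1) by auto
          then have "u \<in> ball x (d x)" "v \<in> ball x (d x)" using \<open>K \<subseteq> ball x (d x)\<close> by auto
          then show "\<bar>u - x\<bar> < d x" "\<bar>v - x\<bar> < d x" by (simp_all add: dist_real_def abs_minus_commute)
        qed
        have "\<bar>h u - h x - (u - x) * g x\<bar> \<le> e1 * (x - u)" "\<bar>h v - h x - (v - x) * g x\<bar> \<le> e1 * (v - x)"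
          using d(2)[of x u] d(2)[of x v] x xN uv by auto
        \<comment> \<open>The tag lies between the endpoints, so the two errors, proportional to x -
          u and v - x, add up to a multiple of the cell length.\<close>
        then have "\<bar>(v - u) * g x - (h v - h u)\<bar> \<le> e1 * (v - u)"
          by (simp add: algebra_simps abs_le_iff)
        then show ?thesis using K x xN by (simp add: g'_def)
      qed
      have 3: "\<bar>measure lborel K * g' x - (h (Sup K) - h (Inf K))\<bar> = \<bar>h (Sup K) - h (Inf K)\<bar>" if "(x, K) \<in> q" for x K
        using that by (auto simp: q_def g'_def)
      have "(\<Sum>(x, K)\<in>p. measure lborel K *\<^sub>R g' x) - (h b - h a) = (\<Sum>(x, K)\<in>p. measure lborel K * g' x - (h (Sup K) - h (Inf K)))"
        using additive_tagged_division_1[OF ab p, of h] by (simp add: sum_subtractf case_prod_unfold)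
      also have "\<bar>\<dots>\<bar> \<le> (\<Sum>(x, K)\<in>p. \<bar>measure lborel K * g' x - (h (Sup K) - h (Inf K))\<bar>)"
        unfolding case_prod_unfold by (rule sum_abs)
      also have "\<dots> = (\<Sum>(x, K)\<in>p - q. \<bar>measure lborel K * g' x - (h (Sup K) - h (Inf K))\<bar>) + (\<Sum>(x, K)\<in>q. \<bar>measure lborel K * g' x - (h (Sup K) - h (Inf K))\<bar>)"
        by (rule sum.subset_diff[OF qp fin(1)])
      also have "(\<Sum>(x, K)\<in>p - q. \<bar>measure lborel K * g' x - (h (Sup K) - h (Inf K))\<bar>) \<le> (\<Sum>(x, K)\<in>p - q. e1 * measure lborel K)"
        by (rule sum_mono) (use 2 in auto)
      also have "\<dots> \<le> (\<Sum>(x, K)\<in>p. e1 * measure lborel K)"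
        by (rule sum_mono2) (use fin e1 in auto)
      also have "\<dots> = e1 * (b - a)"
        using additive_content_tagged_division[of p a b] p ab by (simp add: sum_distrib_left[symmetric] case_prod_unfold)
      also have "(\<Sum>(x, K)\<in>q. \<bar>measure lborel K * g' x - (h (Sup K) - h (Inf K))\<bar>) = (\<Sum>(x, K)\<in>q. \<bar>h (Sup K) - h (Inf K)\<bar>)"
        by (rule sum.cong) (use 3 in auto)
      finally show "norm ((\<Sum>(x, K)\<in>p. measure lborel K *\<^sub>R g' x) - (h b - h a)) < e"
        using 1 e1 by simp
    qed
  qed
  then show ?thesis
    by (rule has_integral_spike[rotated 2]) (use null in \<open>auto simp: negligible_iff_null_sets g'_def\<close>)
qed

section \<open>The equation along a curve and local existence\<close>

lemma continuous_map_histories_tendsto: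
  assumes F: "continuous_map (mtopology_of histories) euclideanreal F"
    and \<phi>: "\<And>n. \<phi> n \<in> mspace histories" "\<phi>0 \<in> mspace histories"
    and unif: "\<And>e. e > 0 \<Longrightarrow> \<forall>\<^sub>F n in sequentially. \<forall>s\<in>{-1..0}. \<bar>\<phi> n s - \<phi>0 s\<bar> \<le> e"
  shows "(\<lambda>n. F (\<phi> n)) \<longlonglongrightarrow> F \<phi>0"
proof -
  interpret Metric_space "mspace histories" "mdist histories"
    by (rule Metric_space_mspace_mdist)
  have "limitin (mtopology_of histories) \<phi> \<phi>0 sequentially"
    unfolding mtopology_of_def limitin_metric
  proof (intro conjI allI impI)
    fix e :: real assume e: "e > 0"
    have "\<forall>\<^sub>F n in sequentially. \<forall>s\<in>{-1..0}. \<bar>\<phi> n s - \<phi>0 s\<bar> \<le> e / 2" using unif[of "e / 2"] e by simp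
    then show "\<forall>\<^sub>F n in sequentially. \<phi> n \<in> mspace histories \<and> mdist histories (\<phi> n) \<phi>0 < e"
    proof (rule eventually_mono)
      fix n assume "\<forall>s\<in>{-1..0}. \<bar>\<phi> n s - \<phi>0 s\<bar> \<le> e / 2"
      then have "mdist histories (\<phi> n) \<phi>0 \<le> e / 2"
        unfolding histories_def using e by (intro mdist_cfunspace_le) (auto simp: dist_real_def)
      then show "\<phi> n \<in> mspace histories \<and> mdist histories (\<phi> n) \<phi>0 < e" using e \<phi> by simp
    qed
  qed (rule \<phi>)
  from continuous_map_limit[OF F this] show ?thesis by (simp add: o_def)
qed

text \<open>A curve is uniformly continuous on compact intervals, so its history moves continuously
  in the supremum metric. The interval {t - 2..t + 1} contains the histories of all times within 1
  of t.\<close>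

lemma seg_tendsto:
  assumes y: "continuous_on UNIV (y :: real \<Rightarrow> real)" and \<tau>: "\<tau> \<longlonglongrightarrow> t" and e: "e > 0"
  shows "\<forall>\<^sub>F n in sequentially. \<forall>s\<in>{-1..0}. \<bar>seg y (\<tau> n) s - seg y t s\<bar> \<le> e"
proof -
  have "uniformly_continuous_on {t - 2..t + 1} y"
    by (intro compact_uniformly_continuous continuous_on_subset[OF y]) auto
  then obtain d where d: "d > 0" "\<And>u v. u \<in> {t - 2..t + 1} \<Longrightarrow> v \<in> {t - 2..t + 1} \<Longrightarrow> dist u v < d \<Longrightarrow> dist (y u) (y v) < e"
    unfolding uniformly_continuous_on_def using e by metis
  have "\<forall>\<^sub>F n in sequentially. dist (\<tau> n) t < min d 1"
    using \<tau> d by (intro tendstoD) auto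
  then show ?thesis
  proof (rule eventually_mono)
    fix n assume n: "dist (\<tau> n) t < min d 1"
    show "\<forall>s\<in>{-1..0}. \<bar>seg y (\<tau> n) s - seg y t s\<bar> \<le> e"
    proof
      fix s :: real assume s: "s \<in> {-1..0}"
      have "dist (y (\<tau> n + s)) (y (t + s)) < e"
        by (rule d(2)) (use n s in \<open>auto simp: dist_real_def abs_less_iff\<close>)
      then show "\<bar>seg y (\<tau> n) s - seg y t s\<bar> \<le> e" using s by (simp add: seg_def dist_real_def)
    qed
  qed
qed

lemma seg_in_histories_UNIV: "continuous_on UNIV y \<Longrightarrow> seg y t \<in> mspace histories"
  by (intro seg_in_histories) (auto intro: continuous_on_subset)

text \<open>Rounding the history time down to the grid of mesh 1/(n + 1) leaves countably many
  histories, where measurability for fixed history applies. Continuity in the history then gives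
  pointwise convergence of the approximations.\<close>

lemma borel_measurable_along_curve:
  assumes meas: "\<And>\<phi>. \<phi> \<in> mspace histories \<Longrightarrow> (\<lambda>t. F t \<phi>) \<in> borel_measurable lebesgue"
    and cont: "\<And>t. continuous_map (mtopology_of histories) euclideanreal (F t)"
    and y: "continuous_on UNIV y"
  shows "(\<lambda>t. F t (seg y t)) \<in> borel_measurable lebesgue"
proof (rule borel_measurable_LIMSEQ_real)
  define \<tau> where "\<tau> n t = real_of_int \<lfloor>real (Suc n) * t\<rfloor> / real (Suc n)" for n t
  have "\<bar>\<tau> n t - t\<bar> \<le> inverse (real (Suc n))" for n t
  proof -
    have "\<bar>real_of_int \<lfloor>real (Suc n) * t\<rfloor> - real (Suc n) * t\<bar> \<le> 1" by linarith
    then have "\<bar>real_of_int \<lfloor>real (Suc n) * t\<rfloor> - real (Suc n) * t\<bar> / real (Suc n) \<le> 1 / real (Suc n)"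
      by (rule divide_right_mono) simp
    moreover have "\<tau> n t - t = (real_of_int \<lfloor>real (Suc n) * t\<rfloor> - real (Suc n) * t) / real (Suc n)"
      unfolding \<tau>_def by (simp add: diff_divide_distrib)
    ultimately show ?thesis by (simp add: inverse_eq_divide del: of_nat_Suc)
  qed
  then have "(\<lambda>n. \<tau> n t - t) \<longlonglongrightarrow> 0" for t
    by (intro Lim_null_comparison[OF _ LIMSEQ_inverse_real_of_nat]) simp
  then have lim: "(\<lambda>n. \<tau> n t) \<longlonglongrightarrow> t" for t
    by (rule LIM_zero_cancel)
  show "(\<lambda>n. F t (seg y (\<tau> n t))) \<longlonglongrightarrow> F t (seg y t)" for t
    by (rule continuous_map_histories_tendsto[OF cont])
      (use seg_in_histories_UNIV[OF y] seg_tendsto[OF y lim] in auto)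
  show "(\<lambda>t. F t (seg y (\<tau> n t))) \<in> borel_measurable lebesgue" for n
    unfolding \<tau>_def
  proof (rule measurable_compose_countable[where f = "\<lambda>i t. F t (seg y (real_of_int i / real (Suc n)))"])
    show "(\<lambda>t. F t (seg y (real_of_int i / real (Suc n)))) \<in> borel_measurable lebesgue" for i
      using meas seg_in_histories_UNIV[OF y] by blast
    have "(\<lambda>t. \<lfloor>real (Suc n) * t\<rfloor>) \<in> borel \<rightarrow>\<^sub>M count_space UNIV" by measurable
    then show "(\<lambda>t. \<lfloor>real (Suc n) * t\<rfloor>) \<in> lebesgue \<rightarrow>\<^sub>M count_space UNIV"
      by (intro measurable_completion) simp
  qed
qed

lemma integrable_along_curve:
  assumes meas: "\<And>\<phi>. \<phi> \<in> mspace histories \<Longrightarrow> (\<lambda>t. F t \<phi>) \<in> borel_measurable lebesgue"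
    and cont: "\<And>t. continuous_map (mtopology_of histories) euclideanreal (F t)"
    and bound: "\<And>t \<phi>. \<phi> \<in> mspace histories \<Longrightarrow> \<bar>F t \<phi>\<bar> \<le> K"
    and y: "continuous_on UNIV y"
  shows "(\<lambda>t. F t (seg y t)) integrable_on {u..v}"
proof (rule measurable_bounded_by_integrable_imp_integrable_real)
  show "(\<lambda>t. F t (seg y t)) \<in> borel_measurable (lebesgue_on {u..v})"
    using borel_measurable_along_curve[OF meas cont y] by (rule measurable_restrict_space1)
  show "(\<lambda>_. K) integrable_on {u..v}" by (rule integrable_const_ivl)
qed (use bound seg_in_histories_UNIV[OF y] in auto)

lemma integral_lipschitz:
  fixes g :: "real \<Rightarrow> real"
  assumes g: "\<And>u v. g integrable_on {u..v}" and bound: "\<And>t. \<bar>g t\<bar> \<le> K"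
  shows "\<bar>integral {w..v} g - integral {w..u} g\<bar> \<le> K * \<bar>v - u\<bar>"
proof -
  have K: "K \<ge> 0" using bound[of 0] by linarith
  have *: "\<bar>integral {w..v} g - integral {w..u} g\<bar> \<le> K * (v - u)" if "u \<le> v" for u v
  proof (cases "w \<le> u")
    case True
    have "integral {w..v} g - integral {w..u} g = integral {u..v} g"
      using Henstock_Kurzweil_Integration.integral_combine[OF True \<open>u \<le> v\<close> g] by simp
    moreover have "norm (integral {u..v} g) \<le> K * (v - u)"
      using has_integral_bound_real[OF K finite.emptyI integrable_integral[OF g], of u v] bound that by auto
    ultimately show ?thesis by simp
  \<comment> \<open>For u < w the interval {w..u} is empty and its integral 0, so the function is
    constant to the left of w.\<close>
  next
    case False
    show ?thesis
    proof (cases "w \<le> v")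
      case True
      have "norm (integral {w..v} g) \<le> K * (v - w)"
        using has_integral_bound_real[OF K finite.emptyI integrable_integral[OF g], of w v] bound True by auto
      also have "\<dots> \<le> K * (v - u)" using False K by (intro mult_left_mono) auto
      finally show ?thesis using False by simp
    qed (use False K that in auto)
  qed
  show ?thesis
  proof (cases "u \<le> v")
    case True then show ?thesis using * by simp
  next
    case False then show ?thesis using *[of v u] by (simp add: abs_minus_commute)
  qed
qed

text \<open>Tonelli's scheme: delaying the integral by \<open>h\<close> makes the \<open>k\<close>-th Picard iterate exact up to
  time \<open>\<omega> + k h\<close>, and the exact solutions for \<open>h = 1/(n+1)\<close> are equicontinuous.\<close>

lemma peano_delay:
  fixes F :: "real \<Rightarrow> (real \<Rightarrow> real) \<Rightarrow> real"
  assumes meas: "\<And>\<phi>. \<phi> \<in> mspace histories \<Longrightarrow> (\<lambda>t. F t \<phi>) \<in> borel_measurable lebesgue"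
    and cont: "\<And>t. continuous_map (mtopology_of histories) euclideanreal (F t)"
    and bound: "\<And>t \<phi>. \<phi> \<in> mspace histories \<Longrightarrow> \<bar>F t \<phi>\<bar> \<le> K"
    and \<phi>0: "continuous_on UNIV \<phi>0"
  obtains y where "continuous_on UNIV y" "\<And>t. t \<le> \<omega> \<Longrightarrow> y t = \<phi>0 t"
    "\<And>t. t \<in> {\<omega>..\<omega> + 1} \<Longrightarrow> ((\<lambda>s. F s (seg y s)) has_integral (y t - \<phi>0 \<omega>)) {\<omega>..t}"
proof -
  define G where "G y s = F s (seg y s)" for y s
  define I where "I y v = integral {\<omega>..v} (G y)" for y v
  define \<Phi> where "\<Phi> h y t = \<phi>0 (min t \<omega>) + I y (t - h)" for h y t
  define base where "base t = \<phi>0 (min t \<omega>)" for t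
  define Y where "Y h k = (\<Phi> h ^^ k) base" for h k
  have base: "continuous_on UNIV base"
    unfolding base_def by (rule continuous_on_compose2[OF \<phi>0]) (auto intro!: continuous_intros)
  have K: "K \<ge> 0" using bound[OF seg_in_histories_UNIV[OF \<phi>0]] by (meson abs_ge_zero order_trans)
  have Gint: "G y integrable_on {u..v}" if "continuous_on UNIV y" for y u v
    unfolding G_def by (rule integrable_along_curve[OF meas cont bound that])
  have Gb: "\<bar>G y s\<bar> \<le> K" if "continuous_on UNIV y" for y s
    unfolding G_def by (rule bound[OF seg_in_histories_UNIV[OF that]])
  have lip: "\<bar>I y v - I y u\<bar> \<le> K * \<bar>v - u\<bar>" if "continuous_on UNIV y" for y u v
    unfolding I_def by (rule integral_lipschitz) (use Gint Gb that in auto)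
  have I0: "I y v = 0" if "v \<le> \<omega>" for y v
    unfolding I_def using that by (cases "v = \<omega>") auto
  have Icont: "continuous_on UNIV (I y)" if "continuous_on UNIV y" for y
  proof -
    have "K-lipschitz_on UNIV (I y)"
      using lip[OF that] K by (auto intro!: lipschitz_onI simp: dist_real_def)
    then show ?thesis by (rule lipschitz_on_continuous_on)
  qed
  have \<Phi>cont: "continuous_on UNIV (\<Phi> h y)" if "continuous_on UNIV y" for h y
  proof -
    have "continuous_on UNIV (\<lambda>t. I y (t - h))"
      by (rule continuous_on_compose2[OF Icont[OF that]]) (auto intro!: continuous_intros)
    then show ?thesis using base unfolding \<Phi>_def base_def by (intro continuous_on_add)
  qed
  have Ycont: "continuous_on UNIV (Y h k)" for h k
    by (induction k) (use base \<Phi>cont in \<open>auto simp: Y_def\<close>)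
  have segeq: "seg y s = seg y' s" if "\<And>r. r \<le> s \<Longrightarrow> y r = y' r" for y y' s
    unfolding seg_def by (rule restrict_ext) (use that in auto)
  have stab: "Y h (Suc k) t = Y h k t" if "h > 0" "t \<le> \<omega> + real k * h" for h k t
    using that(2)
  proof (induction k arbitrary: t)
    case 0
    then show ?case using I0[of "t - h"] that(1) by (simp add: Y_def \<Phi>_def base_def)
  next
    case (Suc k)
    have "I (Y h (Suc k)) (t - h) = I (Y h k) (t - h)"
      unfolding I_def
    proof (rule integral_cong)
      \<comment> \<open>The delay pays off here: the integral at time t sees the iterate only up to
        t - h, where the induction hypothesis already gives equality.\<close>
      fix s assume "s \<in> {\<omega>..t - h}"
      then have "s \<le> \<omega> + real k * h" using Suc.prems by (simp add: algebra_simps)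
      then have "seg (Y h (Suc k)) s = seg (Y h k) s" by (intro segeq Suc.IH) simp
      then show "G (Y h (Suc k)) s = G (Y h k) s" by (simp add: G_def)
    qed
    then have "\<Phi> h (Y h (Suc k)) t = \<Phi> h (Y h k) t" by (simp add: \<Phi>_def)
    then show ?case by (simp add: Y_def)
  qed
  define h where "h n = inverse (real (Suc n))" for n
  have h: "h n > 0" "real (Suc n) * h n = 1" for n by (auto simp: h_def)
  \<comment> \<open>n + 1 steps of length 1/(n + 1) reach exactly \<open>\<omega> + 1\<close>, so on
    that range this iterate is a fixed point of the delayed equation.\<close>
  define y where "y n = Y (h n) (Suc n)" for n
  \<comment> \<open>The integral part is split off because it alone is Lipschitz with a constant
    independent of n; the remaining part does not depend on n.\<close>
  define u where "u n t = I (y n) (t - h n)" for n t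
  have ycont: "continuous_on UNIV (y n)" for n by (simp add: y_def Ycont)
  have yeq: "y n t = base t + u n t" if "t \<le> \<omega> + 1" for n t
  proof -
    have "y n t = \<Phi> (h n) (y n) t"
    proof -
      have "Y (h n) (Suc (Suc n)) t = Y (h n) (Suc n) t" by (rule stab[OF h(1)]) (use that h(2)[of n] in simp)
      then show ?thesis by (simp add: y_def Y_def)
    qed
    then show ?thesis by (simp add: \<Phi>_def base_def u_def)
  qed
  have ulip: "\<bar>u n t - u n s\<bar> \<le> K * \<bar>t - s\<bar>" for n s t
    unfolding u_def using lip[OF ycont, of n "t - h n" "s - h n"] by simp
  have u0: "u n t = 0" if "t \<le> \<omega>" for n t
    unfolding u_def using that h(1)[of n] by (intro I0) simp
  obtain g k where g: "continuous_on {\<omega>..\<omega> + 1} g" and k: "strict_mono (k :: nat \<Rightarrow> nat)"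
    and gk: "\<And>e. 0 < e \<Longrightarrow> \<exists>N. \<forall>n x. n \<ge> N \<and> x \<in> {\<omega>..\<omega> + 1} \<longrightarrow> norm (u (k n) x - g x) < e"
  proof (rule Arzela_Ascoli[of "{\<omega>..\<omega> + 1}" u K])
    fix n x assume x: "x \<in> {\<omega>..\<omega> + 1}"
    have "\<bar>u n x\<bar> \<le> K * \<bar>x - \<omega>\<bar>" using ulip[of n x \<omega>] u0[of \<omega> n] by simp
    also have "\<dots> \<le> K * 1" using x K by (intro mult_left_mono) auto
    finally show "norm (u n x) \<le> K" by simp
  next
    fix x e :: real assume "0 < e"
    have "\<bar>u n x - u n y\<bar> < e" if "\<bar>x - y\<bar> < e / (K + 1)" for n y
    proof -
      have "\<bar>u n x - u n y\<bar> \<le> (K + 1) * \<bar>x - y\<bar>"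
        using ulip[of n x y] by (smt (verit) mult_right_mono abs_ge_zero)
      also have "\<dots> < e" using that K by (simp add: field_simps)
      finally show ?thesis .
    qed
    then show "\<exists>d>0. \<forall>n y. y \<in> {\<omega>..\<omega> + 1} \<and> norm (x - y) < d \<longrightarrow> norm (u n x - u n y) < e"
      using \<open>0 < e\<close> K by (intro exI[of _ "e / (K + 1)"]) auto
  qed auto
  have glim: "(\<lambda>n. u (k n) t) \<longlonglongrightarrow> g t" if "t \<in> {\<omega>..\<omega> + 1}" for t
    by (rule LIMSEQ_I) (use gk that in blast)
  have g0: "g \<omega> = 0" using glim[of \<omega>] u0 by (simp add: LIMSEQ_const_iff)
  define z where "z t = base t + g (max \<omega> (min t (\<omega> + 1)))" for t
  have "continuous_on UNIV (\<lambda>t. g (max \<omega> (min t (\<omega> + 1))))"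
    by (rule continuous_on_compose2[OF g]) (auto intro!: continuous_intros)
  then have zcont: "continuous_on UNIV z" unfolding z_def using base by (intro continuous_on_add)
  have zpre: "z t = \<phi>0 t" if "t \<le> \<omega>" for t using that g0 by (simp add: z_def base_def)
  have Glim: "(\<lambda>n. G (y (k n)) s) \<longlonglongrightarrow> G z s" if s: "s \<le> \<omega> + 1" for s
    unfolding G_def
  proof (rule continuous_map_histories_tendsto[OF cont])
    fix e :: real assume e: "e > 0"
    then obtain N where N: "\<And>n x. n \<ge> N \<Longrightarrow> x \<in> {\<omega>..\<omega> + 1} \<Longrightarrow> norm (u (k n) x - g x) < e" using gk by blast
    have "\<bar>y (k n) r - z r\<bar> \<le> e" if "n \<ge> N" "r \<le> s" for n r
      using yeq[of r "k n"] that s u0[of r "k n"] g0 N[of n r] e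
      by (cases "r \<le> \<omega>") (auto simp: z_def max_def min_def split: if_splits)
    then show "\<forall>\<^sub>F n in sequentially. \<forall>r\<in>{-1..0}. \<bar>seg (y (k n)) s r - seg z s r\<bar> \<le> e"
      unfolding eventually_sequentially by (intro exI[of _ N]) (auto simp: seg_def)
  qed (use seg_in_histories_UNIV ycont zcont in auto)
  have "((\<lambda>s. F s (seg z s)) has_integral (z t - \<phi>0 \<omega>)) {\<omega>..t}" if t: "t \<in> {\<omega>..\<omega> + 1}" for t
  proof -
    have "(\<lambda>n. integral {\<omega>..t} (G (y (k n)))) \<longlonglongrightarrow> integral {\<omega>..t} (G z)"
      by (rule dominated_convergence(2)[where h = "\<lambda>_. K"])
        (use Gint ycont Gb Glim t in \<open>auto intro: integrable_const_ivl\<close>)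
    then have 1: "(\<lambda>n. I (y (k n)) t) \<longlonglongrightarrow> integral {\<omega>..t} (G z)" by (simp add: I_def)
    have hk: "(\<lambda>n. K * h (k n)) \<longlonglongrightarrow> 0"
      using LIMSEQ_subseq_LIMSEQ[OF LIMSEQ_inverse_real_of_nat k] unfolding h_def o_def
      by (intro tendsto_mult_right_zero)
    \<comment> \<open>Removing the delay costs at most K times the step, so the limit solves the
      undelayed integral equation.\<close>
    have "(\<lambda>n. u (k n) t - I (y (k n)) t) \<longlonglongrightarrow> 0"
    proof (rule Lim_null_comparison[OF _ hk])
      have "norm (u (k n) t - I (y (k n)) t) \<le> K * h (k n)" for n
        using lip[OF ycont, of "k n" "t - h (k n)" t] h(1)[of "k n"] by (simp add: u_def)
      then show "\<forall>\<^sub>F n in sequentially. norm (u (k n) t - I (y (k n)) t) \<le> K * h (k n)" by simp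
    qed
    from tendsto_add[OF this 1] have "(\<lambda>n. u (k n) t) \<longlonglongrightarrow> integral {\<omega>..t} (G z)" by simp
    then have "g t = integral {\<omega>..t} (G z)" using glim[OF t] LIMSEQ_unique by blast
    moreover have "z t - \<phi>0 \<omega> = g t" using t by (cases "t = \<omega>") (auto simp: z_def base_def max_def min_def)
    ultimately show ?thesis
      using integrable_integral[OF Gint[OF zcont]] by (simp add: G_def[abs_def])
  qed
  then show ?thesis using that zcont zpre by blast
qed

section \<open>Lebesgue differentiation of an indefinite integral\<close>

lemma indefinite_integral_has_right_derivative:
  fixes g :: "real \<Rightarrow> real"
  assumes g: "\<And>u v. g integrable_on {u..v}"
  obtains N where "negligible N"
    "\<And>x e. x \<notin> N \<Longrightarrow> 0 < e \<Longrightarrow> \<exists>d>0. \<forall>h. 0 < h \<and> h < d \<longrightarrow> \<bar>integral {x..x + h} g / h - g x\<bar> < e"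
proof -
  have "\<And>a b. g integrable_on cbox a b" using g by simp
  then obtain N where N: "negligible N" "\<And>x e. \<lbrakk>x \<notin> N; 0 < e\<rbrakk> \<Longrightarrow>
      \<exists>d>0. \<forall>h. 0 < h \<and> h < d \<longrightarrow> norm (integral (cbox x (x + h *\<^sub>R One)) g /\<^sub>R h ^ DIM(real) - g x) < e"
    by (rule integrable_ccontinuous_explicit) blast
  show ?thesis
  proof (rule that[OF N(1)])
    fix x e :: real assume "x \<notin> N" "0 < e"
    from N(2)[OF this] show "\<exists>d>0. \<forall>h. 0 < h \<and> h < d \<longrightarrow> \<bar>integral {x..x + h} g / h - g x\<bar> < e"
      by (simp add: divide_inverse mult.commute)
  qed
qed

text \<open>Differentiation over intervals with left endpoint x yields only right derivatives. Left
  derivatives are right derivatives of the integral of the reflected function, and reflection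
  preserves null sets.\<close>

lemma indefinite_integral_has_derivative_AE:
  fixes g :: "real \<Rightarrow> real"
  assumes g: "\<And>u v. g integrable_on {u..v}"
  shows "AE x in lebesgue. w < x \<longrightarrow> ((\<lambda>t. integral {w..t} g) has_real_derivative g x) (at x)"
proof -
  obtain N1 where N1: "negligible N1" "\<And>x e. x \<notin> N1 \<Longrightarrow> 0 < e \<Longrightarrow> \<exists>d>0. \<forall>h. 0 < h \<and> h < d \<longrightarrow> \<bar>integral {x..x + h} g / h - g x\<bar> < e"
    using indefinite_integral_has_right_derivative[OF g] by blast
  have "(\<lambda>x. g (- x)) integrable_on {u..v}" for u v
    using Henstock_Kurzweil_Integration.integrable_reflect_real[of g "- u" "- v"] g by simp
  then obtain N2 where N2: "negligible N2" "\<And>x e. x \<notin> N2 \<Longrightarrow> 0 < e \<Longrightarrow> \<exists>d>0. \<forall>h. 0 < h \<and> h < d \<longrightarrow> \<bar>integral {x..x + h} (\<lambda>x. g (- x)) / h - g (- x)\<bar> < e"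
    using indefinite_integral_has_right_derivative[of "\<lambda>x. g (- x)"] by blast
  have "negligible (uminus ` N2)"
    by (rule negligible_differentiable_image_negligible[OF _ N2(1)]) (auto intro!: derivative_intros)
  then have "N1 \<union> uminus ` N2 \<in> null_sets lebesgue"
    using N1(1) by (simp add: negligible_iff_null_sets[symmetric])
  then show ?thesis
  proof (rule AE_I')
    show "{x \<in> space lebesgue. \<not> (w < x \<longrightarrow> ((\<lambda>t. integral {w..t} g) has_real_derivative g x) (at x))} \<subseteq> N1 \<union> uminus ` N2"
    proof (clarsimp, rule ccontr)
      fix x assume wx: "w < x" and nd: "\<not> ((\<lambda>t. integral {w..t} g) has_real_derivative g x) (at x)"
        and x1: "x \<notin> N1" and "x \<notin> uminus ` N2"
      then have x2: "- x \<notin> N2" by (metis add.inverse_inverse image_eqI)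
      have "((\<lambda>t. integral {w..t} g) has_real_derivative g x) (at x)"
        unfolding DERIV_def
      proof (rule LIM_I)
        fix e :: real assume e: "e > 0"
        obtain d1 where d1: "d1 > 0" "\<And>h. 0 < h \<Longrightarrow> h < d1 \<Longrightarrow> \<bar>integral {x..x + h} g / h - g x\<bar> < e"
          using N1(2)[OF x1 e] by blast
        obtain d2 where d2: "d2 > 0" "\<And>h. 0 < h \<Longrightarrow> h < d2 \<Longrightarrow> \<bar>integral {- x..- x + h} (\<lambda>x. g (- x)) / h - g (- (- x))\<bar> < e"
          using N2(2)[OF x2 e] by blast
        have "norm ((integral {w..x + h} g - integral {w..x} g) / h - g x) < e"
          if h: "h \<noteq> 0" "norm (h - 0) < min (x - w) (min d1 d2)" for h
        proof (cases "h > 0")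
          case True
          have "integral {w..x + h} g - integral {w..x} g = integral {x..x + h} g"
            using Henstock_Kurzweil_Integration.integral_combine[of w x "x + h" g] g wx True by simp
          then show ?thesis using d1(2)[of h] h True by simp
        next
          case False
          have "integral {w..x} g - integral {w..x + h} g = integral {x + h..x} g"
            using Henstock_Kurzweil_Integration.integral_combine[of w "x + h" x g] g wx h False by simp
          moreover have "integral {- x..- x + - h} (\<lambda>x. g (- x)) = integral {x + h..x} g"
            using Henstock_Kurzweil_Integration.integral_reflect_real[of x "x + h" g] by simp
          moreover have "\<bar>integral {- x..- x + - h} (\<lambda>x. g (- x)) / (- h) - g x\<bar> < e"
            using d2(2)[of "- h"] h False by simp
          ultimately have "\<bar>(integral {w..x} g - integral {w..x + h} g) / (- h) - g x\<bar> < e" by simp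
          moreover have "(integral {w..x} g - integral {w..x + h} g) / (- h) = (integral {w..x + h} g - integral {w..x} g) / h"
            by (simp add: minus_divide_left[symmetric] diff_divide_distrib)
          ultimately show ?thesis by simp
        qed
        then show "\<exists>s>0. \<forall>h. h \<noteq> 0 \<and> norm (h - 0) < s \<longrightarrow> norm ((integral {w..x + h} g - integral {w..x} g) / h - g x) < e"
          using wx d1(1) d2(1) by (intro exI[of _ "min (x - w) (min d1 d2)"]) auto
      qed
      then show False using nd by blast
    qed
  qed
qed

lemma lipschitz_imp_abs_continuous_on:
  assumes "L-lipschitz_on S (x :: real \<Rightarrow> real)"
  shows "abs_continuous_on S x"
  unfolding abs_continuous_on_def
proof (intro allI impI)
  fix \<epsilon> :: real assume e: "\<epsilon> > 0"
  have L: "L \<ge> 0" using lipschitz_on_nonneg[OF assms] .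
  show "\<exists>\<delta>>0. \<forall>D. finite D \<and> (\<forall>(u, v)\<in>D. u \<le> v \<and> {u..v} \<subseteq> S) \<and>
      disjoint_family_on (\<lambda>(u, v). {u<..<v}) D \<and> (\<Sum>(u, v)\<in>D. v - u) < \<delta> \<longrightarrow> (\<Sum>(u, v)\<in>D. \<bar>x v - x u\<bar>) < \<epsilon>"
  proof (intro exI[of _ "\<epsilon> / (L + 1)"] conjI allI impI)
    show "\<epsilon> / (L + 1) > 0" using e L by simp
    fix D assume D: "finite D \<and> (\<forall>(u, v)\<in>D. u \<le> v \<and> {u..v} \<subseteq> S) \<and>
      disjoint_family_on (\<lambda>(u, v). {u<..<v}) D \<and> (\<Sum>(u, v)\<in>D. v - u) < \<epsilon> / (L + 1)"
    have "(\<Sum>(u, v)\<in>D. \<bar>x v - x u\<bar>) \<le> (\<Sum>(u, v)\<in>D. (L + 1) * (v - u))"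
    proof (rule sum_mono, clarify)
      fix u v assume "(u, v) \<in> D"
      then have uv: "u \<le> v" "{u..v} \<subseteq> S" using D by auto
      then have "u \<in> S" "v \<in> S" by auto
      from lipschitz_onD[OF assms this(2,1)] uv show "\<bar>x v - x u\<bar> \<le> (L + 1) * (v - u)"
        by (simp add: dist_real_def algebra_simps)
    qed
    also have "\<dots> = (L + 1) * (\<Sum>(u, v)\<in>D. v - u)" by (simp add: sum_distrib_left case_prod_unfold)
    also have "\<dots> < (L + 1) * (\<epsilon> / (L + 1))" by (rule mult_strict_left_mono) (use D L in auto)
    finally show "(\<Sum>(u, v)\<in>D. \<bar>x v - x u\<bar>) < \<epsilon>" using L by simp
  qed
qed

text \<open>The bound is first imposed for the histories at rational times, countably many, so one
  null set suffices. For a fixed t outside it, rational times tend to t and continuity of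
  \<open>F t\<close> carries the bound over to the history at t.\<close>

lemma AE_le_along_curve:
  assumes cont: "\<And>t. continuous_map (mtopology_of histories) euclideanreal (F t)"
    and bound: "\<And>\<phi>. \<phi> \<in> mspace histories \<Longrightarrow> (\<forall>s\<in>{-1..0}. \<phi> s \<ge> q) \<Longrightarrow> (AE t in lebesgue. F t \<phi> \<le> \<theta>)"
    and x: "continuous_on {u - 1..v} x" and q: "\<And>s. s \<in> {u - 1..v} \<Longrightarrow> x s \<ge> q"
  shows "AE t in lebesgue. t \<in> {u..v} \<longrightarrow> F t (seg x t) \<le> \<theta>"
proof (cases "u \<le> v")
  case True
  define c where "c t = max u (min t v)" for t
  define y where "y t = x (max (u - 1) (min t v))" for t
  have y: "continuous_on UNIV y"
    unfolding y_def by (rule continuous_on_compose2[OF x]) (use True in \<open>auto intro!: continuous_intros\<close>)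
  have "AE t in lebesgue. \<forall>r\<in>\<rat>. F t (seg y (c r)) \<le> \<theta>"
    unfolding AE_ball_countable[OF countable_rat]
    by (intro ballI bound seg_in_histories_UNIV[OF y]) (auto simp: seg_def y_def intro!: q, use True in linarith)
  then show ?thesis
  proof (rule AE_mp, intro AE_I2 impI)
    fix t assume t: "\<forall>r\<in>\<rat>. F t (seg y (c r)) \<le> \<theta>" "t \<in> {u..v}"
    have "\<exists>r\<in>\<rat>. t - inverse (real (Suc n)) < r \<and> r < t" for n
      by (rule Rats_dense_in_real) simp
    then obtain \<tau> where \<tau>: "\<And>n. \<tau> n \<in> \<rat>" "\<And>n. t - inverse (real (Suc n)) < \<tau> n" "\<And>n. \<tau> n < t" by metis
    have "(\<lambda>n. \<tau> n - t) \<longlonglongrightarrow> 0"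
      by (intro Lim_null_comparison[OF _ LIMSEQ_inverse_real_of_nat])
        (use \<tau>(2,3) in \<open>auto simp: abs_if algebra_simps less_imp_le\<close>)
    then have "\<tau> \<longlonglongrightarrow> t" by (rule LIM_zero_cancel)
    then have "(\<lambda>n. c (\<tau> n)) \<longlonglongrightarrow> c t" unfolding c_def by (intro tendsto_intros)
    then have lim: "(\<lambda>n. c (\<tau> n)) \<longlonglongrightarrow> t" using t by (simp add: c_def)
    have "(\<lambda>n. F t (seg y (c (\<tau> n)))) \<longlonglongrightarrow> F t (seg y t)"
      by (rule continuous_map_histories_tendsto[OF cont])
        (use seg_in_histories_UNIV[OF y] seg_tendsto[OF y lim] in auto)
    then have "F t (seg y t) \<le> \<theta>"
      by (rule LIMSEQ_le_const2) (use t \<tau>(1) in blast)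
    moreover have "seg y t = seg x t"
      unfolding seg_def by (rule restrict_ext) (use t in \<open>auto simp: y_def max_def min_def\<close>)
    ultimately show "F t (seg x t) \<le> \<theta>" by simp
  qed
qed auto

section \<open>Global existence\<close>

lemma bounded_on_Icc:
  fixes x :: "real \<Rightarrow> real"
  assumes "continuous_on {u..v} x"
  obtains B where "B \<ge> 0" "\<And>s. s \<in> {u..v} \<Longrightarrow> \<bar>x s\<bar> \<le> B"
proof -
  have "bounded (x ` {u..v})"
    by (intro compact_imp_bounded compact_continuous_image assms) simp
  then obtain B where "\<And>y. y \<in> x ` {u..v} \<Longrightarrow> norm y \<le> B" unfolding bounded_iff by blast
  then have "\<bar>x s\<bar> \<le> max 0 B" if "s \<in> {u..v}" for s using that by fastforce
  then show ?thesis using that[of "max 0 B"] by simp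
qed

lemma solves_on_has_integral:
  assumes sol: "solves_on f \<alpha> \<omega> x" and uv: "\<alpha> \<le> u" "u \<le> v" "ereal v < \<omega>"
  shows "((\<lambda>t. f t (seg x t)) has_integral (x v - x u)) {u..v}"
proof (rule abs_continuous_on_has_integral[OF uv(2)])
  have sub: "{u..v} \<subseteq> right_open \<alpha> \<omega>"
    using uv by (auto simp: right_open_def intro: le_less_trans[OF _ uv(3)])
  then show "abs_continuous_on {u..v} x"
    using sol unfolding solves_on_def locally_abs_continuous_on_def by blast
  have "AE t in lebesgue. t \<in> right_open \<alpha> \<omega> \<longrightarrow> (x has_real_derivative f t (seg x t)) (at t)"
    using sol unfolding solves_on_def by blast
  then show "AE t in lebesgue. t \<in> {u..v} \<longrightarrow> (x has_real_derivative f t (seg x t)) (at t)"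
    by (rule AE_mp) (intro AE_I2, use sub in blast)
qed

lemma solves_on_continuous_on:
  assumes "solves_on f \<alpha> \<omega> x" "\<alpha> - 1 \<le> u" "ereal v < \<omega>"
  shows "continuous_on {u..v} x"
proof (rule continuous_on_subset)
  show "continuous_on (right_open (\<alpha> - 1) \<omega>) x" using assms(1) by (simp add: solves_on_def)
  show "{u..v} \<subseteq> right_open (\<alpha> - 1) \<omega>"
    using assms by (auto simp: right_open_def intro: le_less_trans[OF _ assms(3)])
qed

lemma has_integral_le_AE:
  fixes g :: "real \<Rightarrow> real"
  assumes g: "(g has_integral I) {u..v}" and "u \<le> v"
    and le: "AE t in lebesgue. t \<in> {u..v} \<longrightarrow> g t \<le> B"
  shows "I \<le> B * (v - u)"
proof -
  obtain N where N: "\<And>t. t \<notin> N \<Longrightarrow> t \<in> {u..v} \<Longrightarrow> g t \<le> B" "N \<in> null_sets lebesgue"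
    using AE_E3[OF le] by auto
  show ?thesis
  proof (rule has_integral_le)
    show "((\<lambda>t. min (g t) B) has_integral I) {u..v}"
      by (rule has_integral_spike[OF _ _ g, of N]) (use N in \<open>auto simp: negligible_iff_null_sets min_def\<close>)
    show "((\<lambda>_. B) has_integral B * (v - u)) {u..v}"
      using has_integral_const_real[of B u v] \<open>u \<le> v\<close> by (simp add: mult.commute)
  qed simp
qed

lemma solution_increment_ge:
  assumes sol: "solves_on f \<alpha> \<omega> x" and uv: "\<alpha> \<le> u" "u \<le> v" "ereal v < \<omega>"
    and le: "\<And>t. t \<in> {u..v} \<Longrightarrow> - B \<le> f t (seg x t)"
  shows "x v - x u \<ge> - B * (v - u)"
proof (rule has_integral_le)
  show "((\<lambda>_. - B) has_integral - B * (v - u)) {u..v}"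
    using has_integral_const_real[of "- B" u v] uv by (simp add: mult.commute)
qed (use solves_on_has_integral[OF sol uv] le in auto)

text \<open>Here c = |a|, and condition (ii) is phrased with an arbitrary bound m on the history in
  place of the maximum functional. Monotonicity of m / (1 + b m) and, below the pole, of m / (1 - b
  m) supplies this form.\<close>

locale delayed_feedback =
  fixes f :: "real \<Rightarrow> (real \<Rightarrow> real) \<Rightarrow> real" and c b :: real
  assumes c: "c > 0" and b: "b \<ge> 0"
    and meas: "\<And>\<phi>. \<phi> \<in> mspace histories \<Longrightarrow> (\<lambda>t. f t \<phi>) \<in> borel_measurable lebesgue"
    and cont: "\<And>t. continuous_map (mtopology_of histories) euclideanreal (f t)"
    and bound: "\<And>q. \<exists>\<theta>\<ge>0. \<forall>\<phi>\<in>mspace histories.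
          (\<forall>s\<in>{-1..0}. \<phi> s \<ge> q) \<longrightarrow> (AE t in lebesgue. f t \<phi> \<le> \<theta>)"
    and lower: "\<And>t \<phi> m. \<phi> \<in> mspace histories \<Longrightarrow> 0 \<le> m \<Longrightarrow> (\<forall>s\<in>{-1..0}. \<phi> s \<le> m) \<Longrightarrow>
          f t \<phi> \<ge> - (c * m / (1 + b * m))"
    and upper: "\<And>t \<phi> m. \<phi> \<in> mspace histories \<Longrightarrow> 0 \<le> m \<Longrightarrow> b * m < 1 \<Longrightarrow>
          (\<forall>s\<in>{-1..0}. - \<phi> s \<le> m) \<Longrightarrow> f t \<phi> \<le> c * m / (1 - b * m)"
begin

lemma lower_linear:
  assumes "\<phi> \<in> mspace histories" "0 \<le> m" "\<forall>s\<in>{-1..0}. \<phi> s \<le> m"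
  shows "f t \<phi> \<ge> - (c * m)"
proof -
  have bm: "b * m \<ge> 0" using b assms by simp
  have "c * m \<ge> 0" using c assms by simp
  from mult_left_mono[OF _ this, of 1 "1 + b * m"] bm
  have "c * m \<le> c * m * (1 + b * m)" by simp
  then have "c * m / (1 + b * m) \<le> c * m" using bm by (simp add: divide_le_eq)
  then show ?thesis using lower[OF assms, of t] by linarith
qed

lemma curve_lower:
  assumes "continuous_on {t - 1..t} x" "0 \<le> m" "\<forall>s\<in>{t - 1..t}. x s \<le> m"
  shows "f t (seg x t) \<ge> - (c * m / (1 + b * m))" "f t (seg x t) \<ge> - (c * m)"
  by (rule lower lower_linear; use assms seg_in_histories in \<open>auto simp: seg_def\<close>)+

lemma curve_upper:
  assumes "continuous_on {t - 1..t} x" "0 \<le> m" "b * m < 1" "\<forall>s\<in>{t - 1..t}. - x s \<le> m"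
  shows "f t (seg x t) \<le> c * m / (1 - b * m)"
  by (rule upper) (use assms seg_in_histories in \<open>auto simp: seg_def\<close>)

text \<open>The constant is chosen before the curve and the interval, so it may be fixed before a
  continuation is constructed.\<close>

lemma curve_upper_AE:
  obtains \<theta> where "\<theta> \<ge> 0"
    "\<And>x u v. continuous_on {u - 1..v} x \<Longrightarrow> (\<And>s. s \<in> {u - 1..v} \<Longrightarrow> x s \<ge> q) \<Longrightarrow>
       AE t in lebesgue. t \<in> {u..v} \<longrightarrow> f t (seg x t) \<le> \<theta>"
proof -
  obtain \<theta> where \<theta>: "\<theta> \<ge> 0" "\<forall>\<phi>\<in>mspace histories.
          (\<forall>s\<in>{-1..0}. \<phi> s \<ge> q) \<longrightarrow> (AE t in lebesgue. f t \<phi> \<le> \<theta>)" using bound by blast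
  show ?thesis
    by (rule that[OF \<theta>(1)], rule AE_le_along_curve[OF cont, where q = q]) (use \<theta>(2) in auto)
qed

text \<open>For b > 0 the slope is at least -c/b, so x is bounded below on a finite interval, and
  then (i) bounds its slope above. For b = 0 the slope is at most c times the maximum of |x|, which
  can be absorbed on a short final interval.\<close>

lemma solution_bounded:
  assumes sol: "solves_on f \<alpha> (ereal w) x"
  shows "\<exists>R\<ge>0. \<forall>t. \<alpha> - 1 \<le> t \<and> t < w \<longrightarrow> \<bar>x t\<bar> \<le> R"
proof -
  have aw: "\<alpha> < w" using sol by (simp add: solves_on_def)
  have xc: "continuous_on {u..v} x" if "\<alpha> - 1 \<le> u" "v < w" for u v
    using solves_on_continuous_on[OF sol that(1)] that(2) by simp
  show ?thesis
  proof (cases "b = 0")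
    case False
    then have b: "b > 0" using b by simp
    obtain B0 where B0: "B0 \<ge> 0" "\<And>s. s \<in> {\<alpha> - 1..\<alpha>} \<Longrightarrow> \<bar>x s\<bar> \<le> B0"
      using bounded_on_Icc[OF xc[of "\<alpha> - 1" \<alpha>]] aw by auto
    define q where "q = - B0 - c / b * (w - \<alpha>)"
    have cb: "c / b * (w - \<alpha>) \<ge> 0" using c b aw by simp
    have low: "x t \<ge> q" if t: "\<alpha> - 1 \<le> t" "t < w" for t
    proof (cases "t \<le> \<alpha>")
      case True
      then show ?thesis using B0(2)[of t] t cb by (auto simp: q_def)
    next
      case False
      have "x t - x \<alpha> \<ge> - (c / b) * (t - \<alpha>)"
      proof (rule solution_increment_ge[OF sol])
        fix s assume s: "s \<in> {\<alpha>..t}"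
        obtain m where m: "m \<ge> 0" "\<And>r. r \<in> {s - 1..s} \<Longrightarrow> \<bar>x r\<bar> \<le> m"
          using bounded_on_Icc[OF xc[of "s - 1" s]] s t by auto
        have "f s (seg x s) \<ge> - (c * m / (1 + b * m))"
          by (rule curve_lower(1)) (use xc[of "s - 1" s] m s t in \<open>auto simp: abs_le_iff\<close>)
        moreover have "c * m / (1 + b * m) \<le> c / b"
        proof -
          have "1 + b * m > 0" using b m by (simp add: add_pos_nonneg)
          then show ?thesis using b c by (simp add: divide_simps)
        qed
        ultimately show "- (c / b) \<le> f s (seg x s)" by linarith
      qed (use False t in auto)
      moreover have "c / b * (t - \<alpha>) \<le> c / b * (w - \<alpha>)" using c b t by (intro mult_left_mono) auto
      ultimately show ?thesis using B0(2)[of \<alpha>] by (simp add: q_def)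
    qed
    obtain \<theta> where \<theta>: "\<theta> \<ge> 0" "\<And>x u v. continuous_on {u - 1..v} x \<Longrightarrow> (\<And>s. s \<in> {u - 1..v} \<Longrightarrow> x s \<ge> q) \<Longrightarrow>
       AE t in lebesgue. t \<in> {u..v} \<longrightarrow> f t (seg x t) \<le> \<theta>"
      using curve_upper_AE[of q] by blast
    have up: "x t \<le> B0 + \<theta> * (w - \<alpha>)" if t: "\<alpha> \<le> t" "t < w" for t
    proof -
      have "x t - x \<alpha> \<le> \<theta> * (t - \<alpha>)"
      proof (rule has_integral_le_AE[OF solves_on_has_integral[OF sol]])
        show "AE s in lebesgue. s \<in> {\<alpha>..t} \<longrightarrow> f s (seg x s) \<le> \<theta>"
          by (rule \<theta>(2)) (use t low xc in auto)
      qed (use t in auto)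
      also have "\<dots> \<le> \<theta> * (w - \<alpha>)" using \<theta> t by (intro mult_left_mono) auto
      finally show ?thesis using B0(2)[of \<alpha>] by (auto simp: abs_le_iff)
    qed
    have \<theta>w: "\<theta> * (w - \<alpha>) \<ge> 0" using \<theta> aw by simp
    have "\<bar>x t\<bar> \<le> B0 + \<theta> * (w - \<alpha>) + c / b * (w - \<alpha>)" if "\<alpha> - 1 \<le> t" "t < w" for t
      using low[of t] up[of t] B0(2)[of t] that \<theta>w cb by (cases "t \<le> \<alpha>") (auto simp: q_def abs_le_iff)
    then show ?thesis using B0(1) \<theta>w cb by (intro exI[of _ "B0 + \<theta> * (w - \<alpha>) + c / b * (w - \<alpha>)"]) auto
  next
    case True
    \<comment> \<open>On a final interval of length at most 1/(2c) the increment of x is at most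
      half the maximum of |x|, which leads to the bound 2 B1.\<close>
    define t1 where "t1 = max \<alpha> (w - 1 / (2 * c))"
    have t1: "\<alpha> \<le> t1" "t1 < w" "c * (w - t1) \<le> 1 / 2"
    proof -
      show "\<alpha> \<le> t1" "t1 < w" using aw c by (auto simp: t1_def)
      have "c * (w - t1) \<le> c * (1 / (2 * c))" using c by (intro mult_left_mono) (auto simp: t1_def)
      then show "c * (w - t1) \<le> 1 / 2" using c by simp
    qed
    obtain B1 where B1: "B1 \<ge> 0" "\<And>s. s \<in> {\<alpha> - 1..t1} \<Longrightarrow> \<bar>x s\<bar> \<le> B1"
      using bounded_on_Icc[OF xc[of "\<alpha> - 1" t1]] t1 by auto
    have "\<bar>x t\<bar> \<le> 2 * B1" if t: "\<alpha> - 1 \<le> t" "t < w" for t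
    proof (cases "t \<le> t1")
      case True
      then show ?thesis using B1(2)[of t] B1(1) t by auto
    next
      case False
      have "continuous_on {\<alpha> - 1..t} (\<lambda>s. \<bar>x s\<bar>)" using xc[of "\<alpha> - 1" t] t by (intro continuous_intros) auto
      then obtain s where s: "s \<in> {\<alpha> - 1..t}" "\<And>r. r \<in> {\<alpha> - 1..t} \<Longrightarrow> \<bar>x r\<bar> \<le> \<bar>x s\<bar>"
        using continuous_attains_sup[of "{\<alpha> - 1..t}" "\<lambda>s. \<bar>x s\<bar>"] t by auto
      have "\<bar>x s\<bar> \<le> 2 * B1"
      proof (cases "s \<le> t1")
        case True
        then show ?thesis using B1(2)[of s] B1(1) s(1) by auto
      next
        case False
        have ge: "- (c * \<bar>x s\<bar>) \<le> f r (seg x r)" "f r (seg x r) \<le> c * \<bar>x s\<bar>" if r: "r \<in> {t1..s}" for r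
        proof -
          have xr: "continuous_on {r - 1..r} x" using r s(1) t t1 by (intro xc) auto
          have m: "\<bar>x l\<bar> \<le> \<bar>x s\<bar>" if "l \<in> {r - 1..r}" for l using s(2)[of l] that r s(1) t1 by auto
          show "- (c * \<bar>x s\<bar>) \<le> f r (seg x r)"
            by (rule curve_lower(2)[OF xr]) (use m in \<open>auto simp: abs_le_iff\<close>)
          have "f r (seg x r) \<le> c * \<bar>x s\<bar> / (1 - b * \<bar>x s\<bar>)"
            by (rule curve_upper[OF xr]) (use m \<open>b = 0\<close> in \<open>auto simp: abs_le_iff\<close>)
          then show "f r (seg x r) \<le> c * \<bar>x s\<bar>" using \<open>b = 0\<close> by simp
        qed
        have sw: "s < w" using s(1) t by auto
        have "x s - x t1 \<ge> - (c * \<bar>x s\<bar>) * (s - t1)"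
          using solution_increment_ge[OF sol t1(1), of s "c * \<bar>x s\<bar>"] ge False sw by auto
        moreover have "x s - x t1 \<le> (c * \<bar>x s\<bar>) * (s - t1)"
          by (rule has_integral_le_AE[OF solves_on_has_integral[OF sol t1(1)]]) (use ge False sw in auto)
        moreover have "(c * \<bar>x s\<bar>) * (s - t1) \<le> \<bar>x s\<bar> / 2"
        proof -
          have "c * (s - t1) \<le> c * (w - t1)" using c sw by simp
          then have "c * (s - t1) \<le> 1 / 2" using t1(3) by linarith
          from mult_left_mono[OF this, of "\<bar>x s\<bar>"] show ?thesis by (simp add: mult_ac)
        qed
        moreover have "\<bar>p\<bar> \<le> \<bar>q\<bar> + d" if "- d' \<le> p - q" "p - q \<le> d'" "d' \<le> d" for p q d d' :: real
          using that by linarith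
        ultimately have "\<bar>x s\<bar> \<le> \<bar>x t1\<bar> + \<bar>x s\<bar> / 2" by (metis minus_mult_left)
        then show ?thesis using B1(2)[of t1] t1 by auto
      qed
      then show ?thesis using s(2)[of t] t by auto
    qed
    then show ?thesis using B1(1) by (intro exI[of _ "2 * B1"]) auto
  qed
qed


lemma solution_lipschitz:
  assumes sol: "solves_on f \<alpha> (ereal w) x" and R: "R \<ge> 0" "\<And>t. \<alpha> - 1 \<le> t \<Longrightarrow> t < w \<Longrightarrow> \<bar>x t\<bar> \<le> R"
  shows "\<exists>L. L-lipschitz_on {\<alpha>..<w} x"
proof -
  have xc: "continuous_on {u..v} x" if "\<alpha> - 1 \<le> u" "v < w" for u v
    using solves_on_continuous_on[OF sol that(1)] that(2) by simp
  obtain \<theta> where \<theta>: "\<theta> \<ge> 0" "\<And>x u v. continuous_on {u - 1..v} x \<Longrightarrow> (\<And>s. s \<in> {u - 1..v} \<Longrightarrow> x s \<ge> - R) \<Longrightarrow>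
       AE t in lebesgue. t \<in> {u..v} \<longrightarrow> f t (seg x t) \<le> \<theta>"
    using curve_upper_AE[of "- R"] by blast
  define L where "L = \<theta> + c * R"
  have cR: "c * R \<ge> 0" using c R by simp
  have inc: "\<bar>x v - x u\<bar> \<le> L * (v - u)" if uv: "\<alpha> \<le> u" "u \<le> v" "v < w" for u v
  proof -
    have "x v - x u \<ge> - (c * R) * (v - u)"
    proof (rule solution_increment_ge[OF sol])
      fix t assume "t \<in> {u..v}"
      then show "- (c * R) \<le> f t (seg x t)"
        using uv R(1) R(2) by (intro curve_lower(2) xc) (auto simp: abs_le_iff)
    qed (use uv in auto)
    moreover have "x v - x u \<le> \<theta> * (v - u)"
    proof (rule has_integral_le_AE[OF solves_on_has_integral[OF sol]])
      have "- R \<le> x s" if "s \<in> {u - 1..v}" for s using R(2)[of s] that uv by (auto simp: abs_le_iff)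
      then show "AE t in lebesgue. t \<in> {u..v} \<longrightarrow> f t (seg x t) \<le> \<theta>"
        using uv by (intro \<theta>(2) xc) auto
    qed (use uv in auto)
    moreover have "\<theta> * (v - u) \<ge> 0" "c * R * (v - u) \<ge> 0" using \<theta> cR uv by auto
    ultimately show ?thesis by (simp add: L_def distrib_right abs_le_iff)
  qed
  have "\<bar>x u - x v\<bar> \<le> L * \<bar>u - v\<bar>" if "u \<in> {\<alpha>..<w}" "v \<in> {\<alpha>..<w}" for u v
    using inc[of u v] inc[of v u] that by (cases "u \<le> v") (auto simp: abs_minus_commute)
  then have "L-lipschitz_on {\<alpha>..<w} x"
    using \<theta> cR by (intro lipschitz_onI) (auto simp: dist_real_def L_def)
  then show ?thesis by blast
qed

text \<open>A bounded solution is Lipschitz near w, hence has a limit there, and the truncated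
  equation is solved from that limit. Over a short time the new piece stays in a region where the
  truncation does not act.\<close>

lemma solution_extends:
  assumes sol: "solves_on f \<alpha> (ereal w) x"
  shows "\<exists>w' y. ereal w < w' \<and> solves_on f \<alpha> w' y \<and> (\<forall>t\<in>right_open (\<alpha> - 1) (ereal w). y t = x t)"
proof -
  have aw: "\<alpha> < w" using sol by (simp add: solves_on_def)
  have xc: "continuous_on {u..v} x" if "\<alpha> - 1 \<le> u" "v < w" for u v
    using solves_on_continuous_on[OF sol that(1)] that(2) by simp
  obtain R where R: "R \<ge> 0" "\<And>t. \<alpha> - 1 \<le> t \<Longrightarrow> t < w \<Longrightarrow> \<bar>x t\<bar> \<le> R"
    using solution_bounded[OF sol] by blast
  obtain L where "L-lipschitz_on {\<alpha>..<w} x" using solution_lipschitz[OF sol R] by blast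
  from lipschitz_extend_closure[OF this] obtain g
    where g: "L-lipschitz_on {\<alpha>..w} g" and gx: "\<And>t. t \<in> {\<alpha>..<w} \<Longrightarrow> g t = x t"
    using aw by auto
  define \<phi>0 where "\<phi>0 t = (if t \<le> \<alpha> then x (max (\<alpha> - 1) (min t \<alpha>)) else g (max \<alpha> (min t w)))" for t
  have \<phi>0x: "\<phi>0 t = x t" if "\<alpha> - 1 \<le> t" "t < w" for t
    using that gx by (auto simp: \<phi>0_def)
  have \<phi>0g: "\<phi>0 t = g t" if "t \<in> {\<alpha>..w}" for t
    using that gx aw by (auto simp: \<phi>0_def max_def)
  have \<phi>0c: "continuous_on UNIV \<phi>0"
  proof -
    have "continuous_on ({..\<alpha>} \<union> {\<alpha>..}) \<phi>0"
      unfolding \<phi>0_def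
    proof (rule continuous_on_cases)
      show "continuous_on {..\<alpha>} (\<lambda>t. x (max (\<alpha> - 1) (min t \<alpha>)))"
        by (rule continuous_on_compose2[OF xc[of "\<alpha> - 1" \<alpha>]]) (use aw in \<open>auto intro!: continuous_intros\<close>)
      show "continuous_on {\<alpha>..} (\<lambda>t. g (max \<alpha> (min t w)))"
        by (rule continuous_on_compose2[OF lipschitz_on_continuous_on[OF g]]) (use aw in \<open>auto intro!: continuous_intros\<close>)
      show "\<forall>t. t \<in> {..\<alpha>} \<and> \<not> t \<le> \<alpha> \<or> t \<in> {\<alpha>..} \<and> t \<le> \<alpha> \<longrightarrow>
          x (max (\<alpha> - 1) (min t \<alpha>)) = g (max \<alpha> (min t w))"
        using gx[of \<alpha>] aw by (auto simp: max_def min_def)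
    qed auto
    moreover have "{..\<alpha>} \<union> {\<alpha>..} = UNIV" by auto
    ultimately show ?thesis by simp
  qed
  \<comment> \<open>The order of choice matters: \<open>R'\<close> leaves a margin of 1,
    \<open>K\<close> bounds the values of f for curves within \<open>R'\<close>, and
    \<open>\<delta>\<close> is chosen so that slope \<open>K\<close> cannot use up the
    margin.\<close>
  define R' where "R' = R + \<bar>\<phi>0 w\<bar> + 1"
  have R': "R' \<ge> 0" using R by (simp add: R'_def)
  obtain \<theta> where \<theta>: "\<theta> \<ge> 0" "\<And>x u v. continuous_on {u - 1..v} x \<Longrightarrow> (\<And>s. s \<in> {u - 1..v} \<Longrightarrow> x s \<ge> - R') \<Longrightarrow>
       AE t in lebesgue. t \<in> {u..v} \<longrightarrow> f t (seg x t) \<le> \<theta>"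
    using curve_upper_AE[of "- R'"] by blast
  define K where "K = \<theta> + c * R'"
  have cR: "c * R' \<ge> 0" using c R' by simp
  have K: "K \<ge> 0" "\<theta> \<le> K" "c * R' \<le> K" using \<theta> cR by (auto simp: K_def)
  define F where "F t \<phi> = max (- K) (min K (f t \<phi>))" for t \<phi>
  have Fmeas: "(\<lambda>t. F t \<phi>) \<in> borel_measurable lebesgue" if "\<phi> \<in> mspace histories" for \<phi>
    unfolding F_def using meas[OF that] by measurable
  have Fcont: "continuous_map (mtopology_of histories) euclideanreal (F t)" for t
    unfolding F_def by (intro continuous_map_real_max continuous_map_real_min cont) auto
  have Fbound: "\<bar>F t \<phi>\<bar> \<le> K" for t \<phi> using K by (auto simp: F_def)
  obtain y where y: "continuous_on UNIV y" "\<And>t. t \<le> w \<Longrightarrow> y t = \<phi>0 t"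
    "\<And>t. t \<in> {w..w + 1} \<Longrightarrow> ((\<lambda>s. F s (seg y s)) has_integral (y t - \<phi>0 w)) {w..t}"
    using peano_delay[where \<omega> = w, OF Fmeas Fcont Fbound \<phi>0c] by blast
  define G where "G s = F s (seg y s)" for s
  have Gint: "G integrable_on {u..v}" for u v
    unfolding G_def by (rule integrable_along_curve[OF Fmeas Fcont Fbound y(1)])
  have yG: "y t = \<phi>0 w + integral {w..t} G" if "t \<in> {w..w + 1}" for t
    using integral_unique[OF y(3)[OF that]] by (simp add: G_def[abs_def])
  have ylip: "K-lipschitz_on {w..w + 1} y"
  proof (rule lipschitz_onI)
    fix u v assume uv: "u \<in> {w..w + 1}" "v \<in> {w..w + 1}"
    show "dist (y u) (y v) \<le> K * dist u v"
      using integral_lipschitz[of G K w u v, OF Gint] Fbound yG[OF uv(1)] yG[OF uv(2)]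
      by (simp add: G_def dist_real_def)
  qed (rule K)
  define \<delta> where "\<delta> = min 1 (1 / (K + 1))"
  have \<delta>: "0 < \<delta>" "\<delta> \<le> 1" "K * \<delta> \<le> 1"
  proof -
    show "0 < \<delta>" "\<delta> \<le> 1" using K by (auto simp: \<delta>_def)
    have "K * \<delta> \<le> K * (1 / (K + 1))" using K by (intro mult_left_mono) (auto simp: \<delta>_def)
    also have "\<dots> \<le> 1" using K by simp
    finally show "K * \<delta> \<le> 1" .
  qed
  have yR: "\<bar>y t\<bar> \<le> R'" if t: "\<alpha> - 1 \<le> t" "t \<le> w + \<delta>" for t
  proof -
    consider "t < w" | "t = w" | "t > w" by linarith
    then show ?thesis
    proof cases
      case 1
      then show ?thesis using y(2)[of t] \<phi>0x[of t] R(2)[of t] t by (simp add: R'_def)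
    next
      case 2
      then show ?thesis using y(2)[of t] R by (simp add: R'_def)
    next
      case 3
      then have "\<bar>y t - y w\<bar> \<le> K * \<bar>t - w\<bar>"
        using lipschitz_onD[OF ylip, of t w] t \<delta> by (simp add: dist_real_def)
      also have "\<dots> \<le> K * \<delta>" using 3 t K by (intro mult_left_mono) auto
      finally show ?thesis using \<delta> y(2)[of w] R by (simp add: R'_def)
    qed
  qed
  \<comment> \<open>Truncation from below is inactive at every time, by the pointwise lower
    estimate; from above only at almost every time, because (i) holds only almost
    everywhere.\<close>
  have FfAE: "AE t in lebesgue. t \<in> {w..w + \<delta>} \<longrightarrow> F t (seg y t) = f t (seg y t)"
  proof -
    have ge: "- K \<le> f t (seg y t)" if "t \<in> {w..w + \<delta>}" for t
    proof -
      have "- (c * R') \<le> f t (seg y t)"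
        by (rule curve_lower(2)) (use yR that aw R' y(1) in \<open>auto simp: abs_le_iff intro: continuous_on_subset\<close>)
      then show ?thesis using K by linarith
    qed
    have "AE t in lebesgue. t \<in> {w..w + \<delta>} \<longrightarrow> f t (seg y t) \<le> \<theta>"
    proof (rule \<theta>(2))
      fix s assume "s \<in> {w - 1..w + \<delta>}"
      then show "- R' \<le> y s" using yR[of s] aw by (auto simp: abs_le_iff)
    qed (use y(1) continuous_on_subset in blast)
    then show ?thesis
      by (rule AE_mp) (intro AE_I2, use ge K in \<open>fastforce simp: F_def\<close>)
  qed
  have yx: "y t = x t" if "\<alpha> - 1 \<le> t" "t < w" for t using y(2)[of t] \<phi>0x that by simp
  have segyx: "seg y t = seg x t" if "\<alpha> \<le> t" "t < w" for t
    unfolding seg_def by (rule restrict_ext) (use that yx in auto)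
  have "solves_on f \<alpha> (ereal (w + \<delta>)) y"
    unfolding solves_on_def
  proof (intro conjI)
    show "ereal \<alpha> < ereal (w + \<delta>)" using aw \<delta> by simp
    show "continuous_on (right_open (\<alpha> - 1) (ereal (w + \<delta>))) y" using y(1) continuous_on_subset by blast
    have "L-lipschitz_on {\<alpha>..w} y"
      using g by (rule lipschitz_on_transform) (use y(2) \<phi>0g in auto)
    from lipschitz_on_concat_max[OF this ylip] have "(max L K)-lipschitz_on {\<alpha>..w + 1} y" by simp
    then show "locally_abs_continuous_on (right_open \<alpha> (ereal (w + \<delta>))) y"
      unfolding locally_abs_continuous_on_def
    proof (intro allI impI lipschitz_imp_abs_continuous_on)
      fix u v assume "{u..v} \<subseteq> right_open \<alpha> (ereal (w + \<delta>))"
      also have "\<dots> \<subseteq> {\<alpha>..w + 1}" using \<delta> by (auto simp: right_open_def)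
      finally show "(max L K)-lipschitz_on {u..v} y"
        using \<open>(max L K)-lipschitz_on {\<alpha>..w + 1} y\<close> lipschitz_on_subset by blast
    qed
    have ne: "AE t in lebesgue. t \<noteq> p" for p :: real
      by (rule AE_I'[of "{p}"]) auto
    note ne[of w] ne[of \<alpha>]
    moreover have "AE t in lebesgue. t \<in> right_open \<alpha> (ereal w) \<longrightarrow> (x has_real_derivative f t (seg x t)) (at t)"
      using sol unfolding solves_on_def by blast
    moreover note indefinite_integral_has_derivative_AE[OF Gint, of w] FfAE
    ultimately show "AE t in lebesgue. t \<in> right_open \<alpha> (ereal (w + \<delta>)) \<longrightarrow> (y has_real_derivative f t (seg y t)) (at t)"
    proof eventually_elim
      case (elim t)
      show ?case
      proof
        assume t: "t \<in> right_open \<alpha> (ereal (w + \<delta>))"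
        show "(y has_real_derivative f t (seg y t)) (at t)"
        proof (cases "t < w")
          case True
          then have "(x has_real_derivative f t (seg x t)) (at t)" using elim t by (auto simp: right_open_def)
          then have "(y has_real_derivative f t (seg x t)) (at t)"
            by (rule has_field_derivative_transform_within_open[of _ _ _ "{\<alpha> - 1<..<w}"])
              (use t True yx in \<open>auto simp: right_open_def\<close>)
          then show ?thesis using segyx[of t] t True by (simp add: right_open_def)
        next
          case False
          then have wt: "w < t" "t < w + \<delta>" using elim t by (auto simp: right_open_def)
          then have "((\<lambda>t. \<phi>0 w + integral {w..t} G) has_real_derivative G t) (at t)"
            using elim by (auto intro!: derivative_eq_intros)
          then have "(y has_real_derivative G t) (at t)"
            by (rule has_field_derivative_transform_within_open[of _ _ _ "{w<..<w + \<delta>}"])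
              (use wt yG \<delta> in auto)
          moreover have "G t = f t (seg y t)" using elim wt by (simp add: G_def)
          ultimately show ?thesis by simp
        qed
      qed
    qed
  qed
  moreover have "\<forall>t\<in>right_open (\<alpha> - 1) (ereal w). y t = x t" using yx by (auto simp: right_open_def)
  moreover have "ereal w < ereal (w + \<delta>)" using \<delta> by simp
  ultimately show ?thesis by blast
qed

lemma maximal_solution_global:
  assumes "is_solution f \<alpha> \<omega> x"
  shows "\<omega> = \<infinity>"
proof (cases \<omega>)
  case (real w)
  then show ?thesis using solution_extends[of \<alpha> w x] assms unfolding is_solution_def by blast
next
  case MInf
  then show ?thesis using assms by (simp add: is_solution_def solves_on_def)
qed

end

section \<open>Convergence to zero\<close>

lemma nonincreasing_bounded_below_tendsto:
  fixes x :: "real \<Rightarrow> real"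
  assumes dec: "\<And>u v. T \<le> u \<Longrightarrow> u \<le> v \<Longrightarrow> x v \<le> x u" and bd: "\<And>t. T \<le> t \<Longrightarrow> B \<le> x t"
  shows "\<exists>L. (x \<longlongrightarrow> L) at_top"
proof (intro exI tendstoI)
  fix e :: real assume "e > 0"
  let ?L = "Inf (x ` {T..})"
  have bdd: "bdd_below (x ` {T..})" using bd by (auto intro!: bdd_belowI[of _ B])
  obtain t where t: "t \<ge> T" "x t < ?L + e"
    using cInf_lessD[of "x ` {T..}" "?L + e"] \<open>e > 0\<close> by auto
  have "dist (x s) ?L < e" if "s \<ge> t" for s
    using cInf_lower[OF _ bdd, of "x s"] dec[of t s] that t by (auto simp: dist_real_def)
  then show "\<forall>\<^sub>F s in at_top. dist (x s) ?L < e" by (auto simp: eventually_at_top_linorder)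
qed

text \<open>On bounded solutions the linear bound with \<open>c < 3/2\<close> is dominated by a rational one with a
  positive parameter, so the case \<open>b = 0\<close> reduces to the case \<open>b > 0\<close>.\<close>

lemma le_feedback:
  assumes "0 < c" "c < 3 / 2" "0 \<le> m" "m \<le> M" "0 < M"
  shows "c * m \<le> feedback ((3 / 2 / c - 1) / M) m"
proof -
  define k where "k = (3 / 2 / c - 1) / M"
  have k: "k > 0" using assms by (simp add: k_def divide_simps)
  have pos: "1 + k * m > 0" using k assms by (simp add: add_pos_nonneg)
  have "k * m \<le> k * M" using k assms by (intro mult_left_mono) auto
  also have "\<dots> = 3 / 2 / c - 1" using assms by (simp add: k_def)
  finally have "c * (1 + k * m) \<le> c * (3 / 2 / c)" using assms by (intro mult_left_mono) auto
  also have "\<dots> = 3 / 2" using assms by simp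
  finally have "m * (c * (1 + k * m)) \<le> m * (3 / 2)" using assms by (intro mult_left_mono) auto
  then have "(c * m) * (1 + k * m) \<le> 3 / 2 * m" by (simp add: mult_ac)
  then show ?thesis unfolding k_def[symmetric] feedback_def by (simp only: pos_le_divide_eq[OF pos])
qed

context delayed_feedback
begin

text \<open>Along a convergent solution the integral of the right-hand side is an increment of x and
  so converges, against (iii). The solution must first be extended to the left by a constant, since
  (iii) integrates from 0 with histories from -1.\<close>

lemma limit_eq_0:
  assumes diverge: "\<And>p L. continuous_on {-1..} p \<Longrightarrow> (p \<longlongrightarrow> L) at_top \<Longrightarrow> L \<noteq> 0 \<Longrightarrow>
          integral_diverges (\<lambda>s. f s (seg p s))"
    and sol: "solves_on f \<alpha> \<infinity> x" and lim: "(x \<longlongrightarrow> L) at_top"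
  shows "L = 0"
proof (rule ccontr)
  assume "L \<noteq> 0"
  define T where "T = max \<alpha> 0"
  define p where "p s = x (max T s)" for s
  define h where "h s = f s (seg p s)" for s
  have xc: "continuous_on {u..v} x" if "\<alpha> - 1 \<le> u" for u v
    using solves_on_continuous_on[OF sol that] by simp
  have "right_open (\<alpha> - 1) \<infinity> = {\<alpha> - 1..}" by (auto simp: right_open_def)
  then have "continuous_on {\<alpha> - 1..} x" using sol by (simp add: solves_on_def)
  then have "continuous_on {-1..} p"
    unfolding p_def by (rule continuous_on_compose2) (auto intro!: continuous_intros simp: T_def)
  moreover have "(p \<longlongrightarrow> L) at_top"
    using lim by (rule Lim_transform_eventually) (auto simp: p_def eventually_at_top_linorder intro!: exI[of _ T])
  ultimately have div: "integral_diverges h" unfolding h_def[abs_def] using diverge \<open>L \<noteq> 0\<close> by blast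
  have hx: "h t = f t (seg x t)" if "t \<ge> T + 1" for t
  proof -
    have "seg p t = seg x t" unfolding seg_def by (rule restrict_ext) (use that in \<open>auto simp: p_def max_def\<close>)
    then show ?thesis by (simp add: h_def)
  qed
  have hint: "(h has_integral x t - x (T + 1)) {T + 1..t}" if "t \<ge> T + 1" for t
  proof (rule has_integral_eq)
    show "((\<lambda>s. f s (seg x s)) has_integral x t - x (T + 1)) {T + 1..t}"
      by (rule solves_on_has_integral[OF sol]) (use that in \<open>auto simp: T_def\<close>)
  qed (use hx in auto)
  \<comment> \<open>The equation gives a gauge integral, whereas (iii) speaks of the Lebesgue
    integral. A lower bound on h turns integrability into absolute integrability.\<close>
  have habs: "h absolutely_integrable_on {T + 1..t}" if "t \<ge> T + 1" for t
  proof -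
    obtain m where m: "m \<ge> 0" "\<And>s. s \<in> {T..t} \<Longrightarrow> \<bar>x s\<bar> \<le> m"
      using bounded_on_Icc[OF xc[of T t]] unfolding T_def by (metis diff_le_eq add_increasing2 max.cobounded1 zero_le_one)
    show ?thesis
    proof (rule absolutely_integrable_absolutely_integrable_lbound)
      show "h integrable_on {T + 1..t}" using hint[OF that] by blast
      show "(\<lambda>_. - (c * m)) absolutely_integrable_on {T + 1..t}" by simp
      fix s assume s: "s \<in> {T + 1..t}"
      have "- (c * m) \<le> f s (seg x s)"
      proof (rule curve_lower(2))
        show "continuous_on {s - 1..s} x" using s by (intro xc) (auto simp: T_def)
        show "\<forall>r\<in>{s - 1..s}. x r \<le> m" using m(2) s by (auto simp: abs_le_iff)
      qed (rule m)
      then show "- (c * m) \<le> h s" using hx s by simp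
    qed
  qed
  have "\<exists>I. ((\<lambda>t. LINT s:{0..t}|lebesgue. h s) \<longlongrightarrow> I) at_top"
  proof (cases "h absolutely_integrable_on {0..T + 1}")
    case True
    have T0: "0 \<le> T + 1" by (simp add: T_def)
    have eq: "(LINT s:{0..t}|lebesgue. h s) = integral {0..T + 1} h + (x t - x (T + 1))" if "t \<ge> T + 1" for t
    proof -
      have un: "{0..t} = {0..T + 1} \<union> {T + 1..t}" using that T0 by auto
      have "h absolutely_integrable_on {0..t}"
        unfolding un by (rule set_integrable_Un[OF True habs[OF that]]) auto
      then have "(LINT s:{0..t}|lebesgue. h s) = integral {0..t} h" "h integrable_on {0..t}"
        by (auto simp: set_lebesgue_integral_eq_integral)
      moreover have "integral {0..t} h = integral {0..T + 1} h + integral {T + 1..t} h"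
        using Henstock_Kurzweil_Integration.integral_combine[OF T0 that \<open>h integrable_on {0..t}\<close>] by simp
      ultimately show ?thesis using integral_unique[OF hint[OF that]] by simp
    qed
    have ev: "\<forall>\<^sub>F t in at_top. integral {0..T + 1} h + (x t - x (T + 1)) = (LINT s:{0..t}|lebesgue. h s)"
      by (rule eventually_mono[OF eventually_ge_at_top[of "T + 1"]]) (rule eq[symmetric])
    have "((\<lambda>t. integral {0..T + 1} h + (x t - x (T + 1))) \<longlongrightarrow> integral {0..T + 1} h + (L - x (T + 1))) at_top"
      by (intro tendsto_intros lim)
    from Lim_transform_eventually[OF this ev] show ?thesis by (rule exI)
  next
    case False
    \<comment> \<open>The Bochner integral of a non-integrable function is 0, so it converges here as well.\<close>
    have eq: "(LINT s:{0..t}|lebesgue. h s) = 0" if "t \<ge> T + 1" for t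
    proof -
      have "\<not> h absolutely_integrable_on {0..t}"
        using False set_integrable_subset[of lebesgue "{0..t}" h "{0..T + 1}"] that by auto
      then show ?thesis
        unfolding set_lebesgue_integral_def set_integrable_def by (rule not_integrable_integral_eq)
    qed
    have "\<forall>\<^sub>F t in at_top. 0 = (LINT s:{0..t}|lebesgue. h s)"
      by (rule eventually_mono[OF eventually_ge_at_top[of "T + 1"]]) (rule eq[symmetric])
    from Lim_transform_eventually[OF tendsto_const this] show ?thesis by (rule exI)
  qed
  then show False using div by (simp add: integral_diverges_def)
qed

section \<open>Solutions of eventually constant sign, and oscillating solutions\<close>

lemma solution_continuous:
  assumes sol: "solves_on f \<alpha> \<infinity> x"
  shows "continuous_on {\<alpha> - 1..} x" "\<alpha> - 1 \<le> u \<Longrightarrow> continuous_on {u..v} x"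
proof -
  have "right_open (\<alpha> - 1) \<infinity> = {\<alpha> - 1..}" by (auto simp: right_open_def)
  then show "continuous_on {\<alpha> - 1..} x" using sol by (simp add: solves_on_def)
  then show "\<alpha> - 1 \<le> u \<Longrightarrow> continuous_on {u..v} x" by (rule continuous_on_subset) auto
qed

lemma solution_has_integral:
  assumes "solves_on f \<alpha> \<infinity> x" "\<alpha> \<le> u" "u \<le> v"
  shows "((\<lambda>t. f t (seg x t)) has_integral (x v - x u)) {u..v}"
  using solves_on_has_integral[OF assms] by simp

text \<open>One delay after x has become nonnegative, the upper estimate with m = 0 makes the slope
  nonpositive, so x decreases towards a limit.\<close>

lemma eventually_nonneg_tendsto:
  assumes sol: "solves_on f \<alpha> \<infinity> x" and pos: "\<And>t. T \<le> t \<Longrightarrow> x t \<ge> 0"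
  shows "\<exists>L. (x \<longlongrightarrow> L) at_top"
proof (rule nonincreasing_bounded_below_tendsto[where T = "max \<alpha> T + 1" and B = 0])
  fix u v :: real assume uv: "max \<alpha> T + 1 \<le> u" "u \<le> v"
  have "x v - x u \<le> 0"
  proof (rule has_integral_le)
    show "((\<lambda>t. f t (seg x t)) has_integral (x v - x u)) {u..v}"
      by (rule solution_has_integral[OF sol]) (use uv in auto)
    fix t assume "t \<in> {u..v}"
    then have "f t (seg x t) \<le> c * 0 / (1 - b * 0)"
      using uv pos by (intro curve_upper solution_continuous[OF sol]) auto
    then show "f t (seg x t) \<le> 0" by simp
  qed (rule has_integral_0)
  then show "x v \<le> x u" by simp
qed (use pos in auto)

lemma eventually_nonpos_tendsto:
  assumes sol: "solves_on f \<alpha> \<infinity> x" and neg: "\<And>t. T \<le> t \<Longrightarrow> x t \<le> 0"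
  shows "\<exists>L. (x \<longlongrightarrow> L) at_top"
proof -
  have "\<exists>L. ((\<lambda>t. - x t) \<longlongrightarrow> L) at_top"
  proof (rule nonincreasing_bounded_below_tendsto[where T = "max \<alpha> T + 1" and B = 0])
    fix u v :: real assume uv: "max \<alpha> T + 1 \<le> u" "u \<le> v"
    have "0 \<le> x v - x u"
    proof (rule has_integral_nonneg)
      show "((\<lambda>t. f t (seg x t)) has_integral (x v - x u)) {u..v}"
        by (rule solution_has_integral[OF sol]) (use uv in auto)
      fix t assume "t \<in> {u..v}"
      then have "f t (seg x t) \<ge> - (c * 0)"
        using uv neg by (intro curve_lower(2) solution_continuous[OF sol]) auto
      then show "0 \<le> f t (seg x t)" by simp
    qed
    then show "- x v \<le> - x u" by simp
  qed (use neg in auto)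
  then show ?thesis using tendsto_minus_cancel_left by fastforce
qed

text \<open>At the first time \<tau> when |x| reaches K + 1, the value M = |x \<tau>| bounds the
  whole past. The excursion estimate on either side of zero then gives |x \<tau>| < M, a
  contradiction. The parameter \<kappa> may depend on M, as only this one time is examined.\<close>

lemma oscillating_bounded:
  assumes sol: "solves_on f \<alpha> \<infinity> x" and b0: "b = 0" and c32: "c < 3 / 2"
    and z: "\<alpha> + 1 \<le> z" "x z = 0"
  shows "\<exists>M>0. \<forall>t\<ge>\<alpha> - 1. \<bar>x t\<bar> \<le> M"
proof -
  note xc = solution_continuous[OF sol]
  obtain K where K: "K \<ge> 0" "\<And>s. s \<in> {\<alpha> - 1..z} \<Longrightarrow> \<bar>x s\<bar> \<le> K"
    using bounded_on_Icc[OF xc(2)[of "\<alpha> - 1" z]] by auto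
  have "\<bar>x t\<bar> \<le> K + 1" if t: "t \<ge> \<alpha> - 1" for t
  proof (rule ccontr)
    assume big: "\<not> \<bar>x t\<bar> \<le> K + 1"
    then have zt: "z \<le> t" using K(2)[of t] t by (cases "z \<le> t") auto
    define Z where "Z = {z..t} \<inter> (\<lambda>s. \<bar>x s\<bar>) -` {K + 1..}"
    have "closed Z" unfolding Z_def
      by (intro continuous_closed_preimage continuous_intros xc(2)) (use z in auto)
    moreover have bdd: "bdd_below Z" by (auto simp: Z_def)
    moreover have "t \<in> Z" using zt big by (simp add: Z_def)
    ultimately have inZ: "Inf Z \<in> Z" by (intro closed_contains_Inf) auto
    define \<tau> where "\<tau> = Inf Z"
    define M where "M = \<bar>x \<tau>\<bar>"
    have \<tau>: "z \<le> \<tau>" "K + 1 \<le> M" using inZ by (auto simp: Z_def \<tau>_def M_def)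
    have M: "M > 0" using \<tau> K by linarith
    have xM: "\<bar>x s\<bar> \<le> M" if s: "\<alpha> - 1 \<le> s" "s \<le> \<tau>" for s
    proof (cases "s \<le> z \<or> s = \<tau>")
      case True
      then show ?thesis using K(2)[of s] s \<tau> by (auto simp: M_def)
    next
      case False
      then have "s \<notin> Z" using cInf_lower[OF _ bdd, of s] s by (auto simp: \<tau>_def)
      then show ?thesis using False s inZ \<tau> by (auto simp: Z_def \<tau>_def)
    qed
    define \<kappa> where "\<kappa> = (3 / 2 / c - 1) / M"
    have \<kappa>: "\<kappa> > 0" using c c32 M by (simp add: \<kappa>_def divide_simps)
    \<comment> \<open>The estimate must hold for every bound m, but \<open>le_feedback\<close>
      covers only m up to M. Larger m are cut down to M, which bounds the history anyway.\<close>
    have fb: "- feedback \<kappa> m \<le> g" if "- (c * min m M) \<le> g" "0 \<le> m" for m g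
    proof -
      have "c * min m M \<le> feedback \<kappa> (min m M)"
        unfolding \<kappa>_def using c c32 M that by (intro le_feedback) auto
      also have "\<dots> \<le> feedback \<kappa> m"
        using that \<kappa> M by (intro feedback_mono) (auto intro!: add_pos_nonneg)
      finally show ?thesis using that by linarith
    qed
    have dpos: "1 + \<kappa> * M > 0" using \<kappa> M by (simp add: add_pos_pos)
    have "x \<tau> \<ge> - excursion \<kappa> M"
    proof (rule excursion_bound_after_zero[where x = x and T = "\<alpha> - 1" and ?t1.0 = \<tau> and z = z
          and g = "\<lambda>t. f t (seg x t)", OF _ dpos])
      fix s m assume s: "s \<in> {\<alpha> - 1 + 1..\<tau>}" and m: "0 \<le> m" "\<forall>r\<in>{s - 1..s}. x r \<le> m"
      have "- (c * min m M) \<le> f s (seg x s)"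
      proof (rule curve_lower(2))
        show "\<forall>r\<in>{s - 1..s}. x r \<le> min m M" using m xM s by (auto simp: abs_le_iff)
      qed (use xc s m M in auto)
      then show "- feedback \<kappa> m \<le> f s (seg x s)" using fb m by blast
    qed (use xc \<tau> z M xM solution_has_integral[OF sol] in \<open>auto simp: abs_le_iff\<close>)
    moreover have "- x \<tau> \<ge> - excursion \<kappa> M"
    proof (rule excursion_bound_after_zero[where x = "\<lambda>t. - x t" and T = "\<alpha> - 1" and ?t1.0 = \<tau> and z = z
          and g = "\<lambda>t. - f t (seg x t)", OF _ dpos])
      fix s m assume s: "s \<in> {\<alpha> - 1 + 1..\<tau>}" and m: "0 \<le> m" "\<forall>r\<in>{s - 1..s}. - x r \<le> m"
      have "f s (seg x s) \<le> c * min m M / (1 - b * min m M)"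
      proof (rule curve_upper)
        show "\<forall>r\<in>{s - 1..s}. - x r \<le> min m M" using m xM s by (auto simp: abs_le_iff)
      qed (use xc s m M b0 in auto)
      then show "- feedback \<kappa> m \<le> - f s (seg x s)" using fb[of m "- f s (seg x s)"] m b0 by simp
    next
      fix u v assume "\<alpha> - 1 + 1 \<le> u" "u \<le> v"
      then show "((\<lambda>t. - f t (seg x t)) has_integral - x v - - x u) {u..v}"
        using has_integral_neg[OF solution_has_integral[OF sol, of u v]] by simp
    qed (use xc \<tau> z M xM in \<open>auto simp: abs_le_iff intro!: continuous_intros\<close>)
    moreover have "excursion \<kappa> M < M"
    proof -
      have "excursion \<kappa> M \<le> 3 * M / (3 + 4 * (\<kappa> * M))"
        using excursion_le_linear_fractional[OF \<kappa>] M by simp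
      also have "\<dots> < M"
      proof -
        have "\<kappa> * M > 0" using \<kappa> M by simp
        then have "3 * M < M * (3 + 4 * (\<kappa> * M))" using M by (simp add: algebra_simps)
        then show ?thesis using \<open>\<kappa> * M > 0\<close> by (simp add: divide_less_eq)
      qed
      finally show ?thesis .
    qed
    ultimately show False by (auto simp: M_def)
  qed
  then show ?thesis using K(1) by (intro exI[of _ "K + 1"]) auto
qed

lemma oscillating_tendsto_0:
  assumes sol: "solves_on f \<alpha> \<infinity> x" and param: "b > 0 \<and> c \<le> 3 / 2 \<or> b = 0 \<and> c < 3 / 2"
    and zeros: "\<And>T. \<exists>z\<ge>T. x z = 0"
  shows "(x \<longlongrightarrow> 0) at_top"
  using param
proof
  assume p: "b > 0 \<and> c \<le> 3 / 2"
  have le: "c * m / d \<le> (3 / 2) * m / d" if "0 \<le> m" "0 < d" for m d :: real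
    using p that by (intro divide_right_mono mult_right_mono) auto
  show ?thesis
  proof (rule tendsto_0_of_oscillation[where T = "\<alpha> - 1" and g = "\<lambda>t. f t (seg x t)"])
    fix t m assume t: "\<alpha> - 1 + 1 \<le> t" and m: "0 \<le> m" "\<forall>s\<in>{t - 1..t}. x s \<le> m"
    have "1 + b * m > 0" using p m by (simp add: add_pos_nonneg)
    then show "- feedback b m \<le> f t (seg x t)"
      using curve_lower(1)[of t x m] le[of m "1 + b * m"] m t solution_continuous(2)[OF sol, of "t - 1" t]
      by (simp add: feedback_def)
  next
    fix t m assume t: "\<alpha> - 1 + 1 \<le> t" and m: "0 \<le> m" "b * m < 1" "\<forall>s\<in>{t - 1..t}. - x s \<le> m"
    then show "f t (seg x t) \<le> feedback (- b) m"
      using curve_upper[of t x m] le[of m "1 - b * m"] solution_continuous(2)[OF sol, of "t - 1" t]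
      by (simp add: feedback_def)
  qed (use p zeros solution_continuous[OF sol] solution_has_integral[OF sol] in auto)
next
  assume p: "b = 0 \<and> c < 3 / 2"
  obtain z where "\<alpha> + 1 \<le> z" "x z = 0" using zeros by blast
  then obtain M where M: "M > 0" "\<And>t. \<alpha> - 1 \<le> t \<Longrightarrow> \<bar>x t\<bar> \<le> M"
    using oscillating_bounded[OF sol] p by blast
  \<comment> \<open>This value makes c m equal to \<open>feedback \<kappa> m\<close> at m = M, the
    largest value needed.\<close>
  define \<kappa> where "\<kappa> = (3 / 2 / c - 1) / M"
  have \<kappa>: "\<kappa> > 0" using c p M by (simp add: \<kappa>_def divide_simps)
  show ?thesis
  proof (rule tendsto_0_of_oscillation[OF \<kappa>, where T = "\<alpha> - 1" and g = "\<lambda>t. f t (seg x t)"])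
    fix t m assume t: "\<alpha> - 1 + 1 \<le> t" and m: "0 \<le> m" "\<forall>s\<in>{t - 1..t}. x s \<le> m"
    have "- (c * min m M) \<le> f t (seg x t)"
    proof (rule curve_lower(2))
      show "\<forall>s\<in>{t - 1..t}. x s \<le> min m M" using m M t by (auto simp: abs_le_iff)
    qed (use solution_continuous[OF sol] t m M in auto)
    moreover have "c * min m M \<le> feedback \<kappa> (min m M)"
      unfolding \<kappa>_def using c p M m by (intro le_feedback) auto
    moreover have "feedback \<kappa> (min m M) \<le> feedback \<kappa> m"
      using m \<kappa> M by (intro feedback_mono) (auto intro!: add_pos_nonneg)
    ultimately show "- feedback \<kappa> m \<le> f t (seg x t)" by linarith
  next
    fix t m assume t: "\<alpha> - 1 + 1 \<le> t" and m: "0 \<le> m" "\<kappa> * m < 1" "\<forall>s\<in>{t - 1..t}. - x s \<le> m"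
    have "f t (seg x t) \<le> c * m / (1 - b * m)"
      by (rule curve_upper) (use t m p solution_continuous[OF sol] in auto)
    \<comment> \<open>On this side the artificial denominator 1 - \<kappa> m is at most 1, so it
      only weakens the linear bound; the gap between c and 3/2 is spent on the lower side.\<close>
    then have "f t (seg x t) \<le> (3 / 2) * m" using p m mult_right_mono[of c "3 / 2" m] by simp
    also have "\<dots> \<le> feedback (- \<kappa>) m"
    proof -
      have "\<kappa> * (m * m) \<ge> 0" using \<kappa> by simp
      then show ?thesis using m by (simp add: feedback_def pos_le_divide_eq algebra_simps)
    qed
    finally show "f t (seg x t) \<le> feedback (- \<kappa>) m" .
  qed (use zeros solution_continuous[OF sol] solution_has_integral[OF sol] in auto)
qed

text \<open>A solution without a limit is neither eventually nonnegative nor eventually nonpositive,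
  so it changes sign arbitrarily late and has arbitrarily late zeros.\<close>

lemma solution_tendsto_0:
  assumes diverge: "\<And>p L. continuous_on {-1..} p \<Longrightarrow> (p \<longlongrightarrow> L) at_top \<Longrightarrow> L \<noteq> 0 \<Longrightarrow>
          integral_diverges (\<lambda>s. f s (seg p s))"
    and sol: "solves_on f \<alpha> \<infinity> x" and param: "b > 0 \<and> c \<le> 3 / 2 \<or> b = 0 \<and> c < 3 / 2"
  shows "(x \<longlongrightarrow> 0) at_top"
proof (cases "\<exists>L. (x \<longlongrightarrow> L) at_top")
  case True
  then obtain L where L: "(x \<longlongrightarrow> L) at_top" by blast
  have "L = 0" by (rule limit_eq_0[OF _ sol L]) (rule diverge)
  then show ?thesis using L by simp
next
  case False
  have "\<exists>z\<ge>T. x z = 0" for T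
  proof -
    obtain s where s: "max \<alpha> T \<le> s" "x s < 0"
      using False eventually_nonneg_tendsto[OF sol, of "max \<alpha> T"] by (meson not_le)
    obtain t where t: "max \<alpha> T \<le> t" "x t > 0"
      using False eventually_nonpos_tendsto[OF sol, of "max \<alpha> T"] by (meson not_le)
    show ?thesis
    proof (cases "s \<le> t")
      case True
      then obtain z where "s \<le> z" "z \<le> t" "x z = 0"
        using IVT'[of x s 0 t] s t solution_continuous(2)[OF sol, of s t] by auto
      then show ?thesis using s by (intro exI[of _ z]) auto
    next
      case False
      then obtain z where "t \<le> z" "z \<le> s" "x z = 0"
        using IVT2'[of x s 0 t] s t solution_continuous(2)[OF sol, of t s] by auto
      then show ?thesis using t by (intro exI[of _ z]) auto
    qed
  qed
  then show ?thesis by (rule oscillating_tendsto_0[OF sol param])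
qed

end

theorem theorem2:
  fixes f :: "real \<Rightarrow> (real \<Rightarrow> real) \<Rightarrow> real" and a b :: real and r :: "real \<Rightarrow> real"
  assumes a: "a < 0" and b: "b \<ge> 0"
    and r: "\<And>x. r x = a * x / (1 + b * x)"
    and carath: "caratheodory f"
    and bound: "\<And>q. \<exists>\<theta>\<ge>0. \<forall>\<phi>\<in>mspace histories.
          (\<forall>s\<in>{-1..0}. \<phi> s \<ge> q) \<longrightarrow> (AE t in lebesgue. f t \<phi> \<le> \<theta>)"
    and lower: "\<And>t \<phi>. \<phi> \<in> mspace histories \<Longrightarrow> f t \<phi> \<ge> r (yorke_max \<phi>)"
    and upper: "\<And>t \<phi>. \<phi> \<in> mspace histories \<Longrightarrow>
          b = 0 \<or> (INF s\<in>{-1..0}. \<phi> s) > - inverse b \<Longrightarrow>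
          f t \<phi> \<le> r (- yorke_max (\<lambda>s. - \<phi> s))"
    and diverge: "\<And>p L. continuous_on {-1..} p \<Longrightarrow> (p \<longlongrightarrow> L) at_top \<Longrightarrow> L \<noteq> 0 \<Longrightarrow>
          integral_diverges (\<lambda>s. f s (seg p s))"
    and param: "(b > 0 \<and> \<bar>a\<bar> \<le> 3 / 2) \<or> (b = 0 \<and> \<bar>a\<bar> < 3 / 2)"
  shows "\<forall>\<alpha> \<omega> x. is_solution f \<alpha> \<omega> x \<longrightarrow> \<omega> = \<infinity> \<and> (x \<longlongrightarrow> 0) at_top"
proof -
  have ym: "0 \<le> yorke_max \<phi>" "yorke_max \<phi> \<le> m" if "0 \<le> m" "\<forall>s\<in>{-1..0}. \<phi> s \<le> m" for \<phi> m
  proof -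
    have "(SUP s\<in>{-1..0}. \<phi> s) \<le> m" using that by (intro cSUP_least) auto
    then show "0 \<le> yorke_max \<phi>" "yorke_max \<phi> \<le> m" using that by (auto simp: yorke_max_def)
  qed
  \<comment> \<open>The sign of d is left free: d = b serves the lower condition and d = -b the
    upper one.\<close>
  have rmono: "- a * n / (1 + d * n) \<le> - a * m / (1 + d * m)" if "0 \<le> n" "n \<le> m" "1 + d * m > 0" for d n m :: real
  proof -
    have "1 + d * n > 0" using feedback_denom_pos that by blast
    moreover have "- a * n \<le> - a * m" using a that by (intro mult_left_mono) auto
    ultimately show ?thesis using that by (simp add: divide_simps) (simp add: algebra_simps)
  qed
  interpret delayed_feedback f "- a" b
  proof
    fix t m :: real and \<phi> assume \<phi>: "\<phi> \<in> mspace histories" and m: "0 \<le> m" "\<forall>s\<in>{-1..0}. \<phi> s \<le> m"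
    have "1 + b * m > 0" using b m by (simp add: add_pos_nonneg)
    from rmono[OF ym[OF m] this] show "- (- a * m / (1 + b * m)) \<le> f t \<phi>"
      using lower[OF \<phi>, of t] by (simp add: r)
  next
    fix t m :: real and \<phi>
    assume \<phi>: "\<phi> \<in> mspace histories" and m: "0 \<le> m" "b * m < 1" "\<forall>s\<in>{-1..0}. - \<phi> s \<le> m"
    have "b = 0 \<or> (INF s\<in>{-1..0}. \<phi> s) > - inverse b"
    proof (cases "b = 0")
      case False
      have "- m \<le> (INF s\<in>{-1..0}. \<phi> s)" using m(3) by (intro cINF_greatest) force+
      moreover have "m < inverse b" using False b m by (simp add: field_simps)
      ultimately show ?thesis by linarith
    qed simp
    from upper[OF \<phi> this, of t]
    have "f t \<phi> \<le> - a * yorke_max (\<lambda>s. - \<phi> s) / (1 + - b * yorke_max (\<lambda>s. - \<phi> s))" by (simp add: r)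
    also have "\<dots> \<le> - a * m / (1 + - b * m)"
      using m by (intro rmono ym) auto
    finally show "f t \<phi> \<le> - a * m / (1 - b * m)" by simp
  qed (use a b bound carath in \<open>auto simp: caratheodory_def\<close>)
  have param': "b > 0 \<and> - a \<le> 3 / 2 \<or> b = 0 \<and> - a < 3 / 2" using param a by auto
  show ?thesis
  proof (intro allI impI)
    fix \<alpha> \<omega> x assume x: "is_solution f \<alpha> \<omega> x"
    then have \<omega>: "\<omega> = \<infinity>" by (rule maximal_solution_global)
    then have sol: "solves_on f \<alpha> \<infinity> x" using x by (simp add: is_solution_def)
    have "(x \<longlongrightarrow> 0) at_top" by (rule solution_tendsto_0[OF _ sol param']) (rule diverge)
    with \<omega> show "\<omega> = \<infinity> \<and> (x \<longlongrightarrow> 0) at_top" by simp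
  qed
qed

end
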